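(* Let $q\ge 3$ and let $i,j,n$ be integers with $0\le i\le j$ and $n\ge i+j$. Let $f:\Sigma_q^n\to\mathbb{R}$ with $f\in U_{[i,j]}(n,q)$ and $f\not\equiv 0$. Then $|f|\ge 2^{i}(q-1)^{i}q^{n-i-j}$. Moreover, $|f|=2^{i}(q-1)^{i}q^{n-i-j}$ holds if and only if $f_\sigma\in F_1(n,q,i,j)$ for some permutation $\sigma\in S_n$.
   Context: $\Sigma_q=\{0,1,\dots,q-1\}$. The Hamming graph $H(n,q)$ has vertex set $\Sigma_q^n$, two vertices being adjacent iff they differ in exactly one coordinate. A function $f:\Sigma_q^n\to\mathbb{R}$ is a $\lambda$-eigenfunction of $H(n,q)$ if $\lambda f(x)=\sum_{y\text{ adjacent to }x}f(y)$ for all $x$. For an integer $t$, $\lambda_t(n,q)=n(q-1)-qt$ and $U_t(n,q)$ is the space of $\lambda_t(n,q)$-eigenfunctions of $H(n,q)$ (the eigenvalues of $H(n,q)$ are $\lambda_t(n,q)$, $0\le t\le n$). For $i\le j$, $U_{[i,j]}(n,q)=U_i(n,q)\oplus\cdots\oplus U_j(n,q)$. $|f|$ denotes the number of $x$ with $f(x)\ne0$. For $\sigma\in S_n$, $f_\sigma(x_1,\dots,x_n)=f(x_{\sigma(1)},\dots,x_{\sigma(n)})$. Elementary functions: for $k,m\in\Sigma_q$, $a_1(k,m):\Sigma_q^2\to\mathbb{R}$ is $1$ if $x=k,y\ne m$; $-1$ if $y=m,x\ne k$; $0$ otherwise; $A_1$ is the set of all $a_1(k,m)$. $A_3$ consists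 of the constant function $1$ on $\Sigma_q$. For $m\in\Sigma_q$, $a_4(m):\Sigma_q\to\mathbb{R}$ is the indicator of $\{m\}$; $A_4$ is the set of all $a_4(m)$. If $f_1,\dots,f_s$ are functions on $\Sigma_q^{n_1},\dots,\Sigma_q^{n_s}$, their product $f_1\cdots f_s$ is the function on $\Sigma_q^{n_1+\dots+n_s}$ given by $(x^{(1)},\dots,x^{(s)})\mapsto\prod_t f_t(x^{(t)})$ (consecutive blocks of coordinates, in the given order). For $n\ge i+j$, $F_1(n,q,i,j)$ is the set of functions $f:\Sigma_q^n\to\mathbb{R}$ of the form $f=c\cdot\prod_{k=1}^{i}g_k\cdot\prod_{k=1}^{n-i-j}h_k\cdot\prod_{k=1}^{j-i}v_k$ with $c$ a real constant, $g_k\in A_1$, $h_k\in A_3$, $v_k\in A_4$. *)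

theory Defs
  imports Complex_Main "HOL-Combinatorics.Permutations"
begin

text \<open>A function on \<open>\<Sigma>\<^sub>q\<^sup>n\<close> is represented by a function on lists of natural numbers of which only
  the values on \<open>words n q\<close> matter; all notions below look at these values only. Coordinates are
  numbered from 0.\<close>

definition words :: "nat \<Rightarrow> nat \<Rightarrow> nat list set" where
  "words n q = {x. set x \<subseteq> {..<q} \<and> length x = n}"

definition hamming_adj :: "nat \<Rightarrow> nat list \<Rightarrow> nat list \<Rightarrow> bool" where
  "hamming_adj n x y \<longleftrightarrow> card {k. k < n \<and> x ! k \<noteq> y ! k} = 1"

definition eigenfunction :: "nat \<Rightarrow> nat \<Rightarrow> real \<Rightarrow> (nat list \<Rightarrow> real) \<Rightarrow> bool" where
  "eigenfunction n q l f \<longleftrightarrow>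
     (\<forall>x\<in>words n q. l * f x = (\<Sum>y | y \<in> words n q \<and> hamming_adj n x y. f y))"

definition eigval :: "nat \<Rightarrow> nat \<Rightarrow> nat \<Rightarrow> real" where
  "eigval t n q = real n * (real q - 1) - real q * real t"

definition U :: "nat \<Rightarrow> nat \<Rightarrow> nat \<Rightarrow> (nat list \<Rightarrow> real) set" where
  "U t n q = {f. eigenfunction n q (eigval t n q) f}"

text \<open>The sum of the eigenspaces \<open>U t n q\<close> for \<open>i \<le> t \<le> j\<close>; on \<open>words n q\<close> it is direct, since
  the eigenvalues are pairwise distinct for \<open>q > 0\<close>.\<close>

definition U_range :: "nat \<Rightarrow> nat \<Rightarrow> nat \<Rightarrow> nat \<Rightarrow> (nat list \<Rightarrow> real) set" where
  "U_range i j n q = {f. \<exists>g. (\<forall>t\<in>{i..j}. g t \<in> U t n q) \<and>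
                             (\<forall>x\<in>words n q. f x = (\<Sum>t=i..j. g t x))}"

definition supp_size :: "nat \<Rightarrow> nat \<Rightarrow> (nat list \<Rightarrow> real) \<Rightarrow> nat" where
  "supp_size n q f = card {x \<in> words n q. f x \<noteq> 0}"

text \<open>\<open>permute_list \<sigma> x\<close> is the list \<open>x ! \<sigma> 0, x ! \<sigma> 1, \<dots>\<close>.\<close>

definition permute_fun :: "(nat \<Rightarrow> nat) \<Rightarrow> (nat list \<Rightarrow> real) \<Rightarrow> nat list \<Rightarrow> real" where
  "permute_fun \<sigma> f x = f (permute_list \<sigma> x)"

definition a1 :: "nat \<Rightarrow> nat \<Rightarrow> nat list \<Rightarrow> real" where
  "a1 k m z = (if z ! 0 = k \<and> z ! 1 \<noteq> m then 1
               else if z ! 1 = m \<and> z ! 0 \<noteq> k then -1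
               else 0)"

definition A1 :: "nat \<Rightarrow> (nat list \<Rightarrow> real) set" where
  "A1 q = {a1 k m | k m. k < q \<and> m < q}"

definition A3 :: "(nat list \<Rightarrow> real) set" where
  "A3 = {\<lambda>z. 1}"

definition a4 :: "nat \<Rightarrow> nat list \<Rightarrow> real" where
  "a4 m z = (if z ! 0 = m then 1 else 0)"

definition A4 :: "nat \<Rightarrow> (nat list \<Rightarrow> real) set" where
  "A4 q = {a4 m | m. m < q}"

text \<open>Each factor is paired with the number of coordinates it consumes.\<close>

fun block_prod :: "(nat \<times> (nat list \<Rightarrow> real)) list \<Rightarrow> nat list \<Rightarrow> real" where
  "block_prod [] x = 1"
| "block_prod ((m, g) # gs) x = g (take m x) * block_prod gs (drop m x)"

text \<open>Meaningful for \<open>i \<le> j\<close> and \<open>i + j \<le> n\<close>, where the subtractions do not truncate.\<close>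

definition F1 :: "nat \<Rightarrow> nat \<Rightarrow> nat \<Rightarrow> nat \<Rightarrow> (nat list \<Rightarrow> real) set" where
  "F1 n q i j = {f. \<exists>c gs hs vs.
      length gs = i \<and> set gs \<subseteq> A1 q \<and>
      length hs = n - i - j \<and> set hs \<subseteq> A3 \<and>
      length vs = j - i \<and> set vs \<subseteq> A4 q \<and>
      (\<forall>x\<in>words n q.
         f x = c * block_prod (map (Pair 2) gs @ map (Pair 1) hs @ map (Pair 1) vs) x)}"

end

theory Submission
  imports Defs "HOL-Library.FuncSet"
begin

text \<open>
  Fix a coordinate and let \<open>f\<^sub>k\<close> be the restrictions of \<open>f\<close> to the \<open>q\<close> values of that coordinate. If
  \<open>f \<in> U\<^bsub>[i,j]\<^esub>\<close>, then on \<open>n - 1\<close> coordinates \<open>f\<^sub>k \<in> U\<^bsub>[i-1,j]\<^esub>\<close>, \<open>f\<^sub>k - f\<^sub>m \<in> U\<^bsub>[i-1,j-1]\<^esub>\<close> and \<open>\<Sum>\<^sub>k f\<^sub>k \<in> U\<^bsub>[i,j]\<^esub>\<close>.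
  Choose a coordinate in which \<open>f\<close> is not constant, and let \<open>i \<ge> 1\<close>. By induction, with
  \<open>\<beta> = N(n-1,i-1,j)\<close> where \<open>N(n,i,j)\<close> is the claimed minimum, every nonzero slice has support at least \<open>\<beta>\<close>, two
  different slices together have support at least \<open>q\<beta>\<close>, and \<open>N(n,i,j) = 2(q-1)\<beta>\<close>. If two disjoint
  pairs of slices differ, or \<open>q = 3\<close> and all slices differ, the bound is strict. Otherwise all slices but \<open>f\<^sub>k\<close> coincide: either they
  vanish and \<open>f\<^sub>k \<in> U\<^bsub>[i,j-1]\<^esub>\<close>, or the bound follows by adding up.

  For equality in the latter case, a slice \<open>h\<close> other than \<open>f\<^sub>k\<close> is extremal for \<open>(i-1,j)\<close> and so is
  supported on \<open>y = m\<close> for some coordinate \<open>y\<close>. Slicing \<open>f\<close> along \<open>y\<close> and counting shows that \<open>f\<close> lives on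
  \<open>{x = k, y \<noteq> m} \<union> {x \<noteq> k, y = m}\<close>. The difference \<open>f\<^sub>k - h\<close> is extremal for \<open>(i-1,j-1)\<close> and all its
  slices along \<open>y\<close> have equal support, which forces it to be constant in \<open>y\<close>; so
  \<open>f = a\<^sub>1(k,m) u\<close> with \<open>u\<close> extremal for \<open>(i-1,j-1)\<close> on \<open>n - 2\<close> coordinates.
\<close>

subsection \<open>Slices, degree and orthogonality\<close>

locale alphabet =
  fixes q :: nat
  assumes q3: "3 \<le> q"
begin

text \<open>Words are functions on a finite set \<open>I\<close> of coordinates rather than lists, so that
  deleting any coordinate is as easy as deleting the first one.\<close>

definition Om :: "nat set \<Rightarrow> (nat \<Rightarrow> nat) set" where
  "Om I = I \<rightarrow>\<^sub>E {..<q}"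

definition slice :: "nat \<Rightarrow> nat \<Rightarrow> ((nat \<Rightarrow> nat) \<Rightarrow> real) \<Rightarrow> (nat \<Rightarrow> nat) \<Rightarrow> real" where
  "slice r k f = (\<lambda>x. f (x(r := k)))"

lemma slice_apply [simp]: "slice r k f x = f (x(r := k))"
  by (simp add: slice_def)

lemma Om_upd: "x \<in> Om (I - {r}) \<Longrightarrow> r \<in> I \<Longrightarrow> k < q \<Longrightarrow> x(r := k) \<in> Om I"
  by (auto simp: Om_def PiE_iff extensional_def)

lemma Om_upd_same: "x \<in> Om I \<Longrightarrow> r \<in> I \<Longrightarrow> k < q \<Longrightarrow> x(r := k) \<in> Om I"
  by (auto simp: Om_def PiE_iff extensional_def)

lemma Om_less: "x \<in> Om I \<Longrightarrow> r \<in> I \<Longrightarrow> x r < q"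
  by (auto simp: Om_def PiE_iff)

text \<open>\<open>undefined\<close> is the value of a word outside its coordinates, so this
  assignment deletes coordinate \<open>r\<close>.\<close>

lemma Om_remove: "x \<in> Om I \<Longrightarrow> x(r := undefined) \<in> Om (I - {r})"
  by (auto simp: Om_def PiE_iff extensional_def)

lemma finite_Om: "finite I \<Longrightarrow> finite (Om I)"
  by (auto simp: Om_def intro: finite_PiE)

lemma card_Om: "finite I \<Longrightarrow> card (Om I) = q ^ card I"
  by (simp add: Om_def card_PiE)

lemma sum_Om_split:
  assumes "r \<in> I"
  shows "(\<Sum>x\<in>Om I. F x) = (\<Sum>k<q. \<Sum>x\<in>Om (I - {r}). F (x(r := k)))"
proof -
  let ?u = "\<lambda>(k, x). x(r := k)"
  have I: "insert r (I - {r}) = I" using assms by auto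
  have "Om I = ?u ` ({..<q} \<times> Om (I - {r}))"
    using PiE_insert_eq[of r "I - {r}" "\<lambda>_. {..<q}"] by (simp add: Om_def I del: insert_Diff_single)
  moreover have "inj_on ?u ({..<q} \<times> Om (I - {r}))"
    using inj_combinator[of r "I - {r}" "\<lambda>_. {..<q}"] by (simp add: Om_def)
  ultimately have "(\<Sum>x\<in>Om I. F x) = (\<Sum>p\<in>{..<q} \<times> Om (I - {r}). F (?u p))"
    by (simp add: sum.reindex)
  also have "\<dots> = (\<Sum>k<q. \<Sum>x\<in>Om (I - {r}). F (x(r := k)))"
    by (simp add: sum.cartesian_product split_def)
  finally show ?thesis .
qed

definition const_at :: "nat \<Rightarrow> nat set \<Rightarrow> ((nat \<Rightarrow> nat) \<Rightarrow> real) \<Rightarrow> bool" where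
  "const_at r I f \<longleftrightarrow> (\<forall>k<q. \<forall>m<q. \<forall>x\<in>Om (I - {r}). f (x(r := k)) = f (x(r := m)))"

lemma const_at_upd:
  assumes "const_at r I f" "r \<in> I" "x \<in> Om I" "k < q"
  shows "f (x(r := k)) = f x"
  using assms Om_remove[of x I r] Om_less[of x I r] unfolding const_at_def
  by (metis fun_upd_triv fun_upd_upd)

text \<open>Turn \<open>x\<close> into \<open>y\<close> one coordinate at a time; \<open>S\<close>
  contains the coordinates in which they may still differ.\<close>

lemma all_const_at_imp_const:
  assumes "finite I" "\<And>r. r \<in> I \<Longrightarrow> const_at r I f" "x \<in> Om I" "y \<in> Om I"
  shows "f x = f y"
proof -
  have "f x = f y" if "finite S" "S \<subseteq> I" "x \<in> Om I" "\<forall>r\<in>I - S. x r = y r" for S x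
    using that
  proof (induction S arbitrary: x rule: finite_induct)
    case empty
    then have "x = y" using assms(4) unfolding Om_def
      by (metis DiffI PiE_ext ex_in_conv)
    then show ?case by simp
  next
    case (insert r S)
    have yr: "y r < q" using insert.prems assms(4) Om_less by blast
    have "f (x(r := y r)) = f y"
      by (rule insert.IH) (use insert.prems yr in \<open>auto intro: Om_upd_same simp del: fun_upd_apply\<close>, simp)
    then show ?case using const_at_upd[of r I f x "y r"] insert.prems assms(2) yr by auto
  qed
  from this[of I x] assms show ?thesis by auto
qed

section \<open>Support sizes under slicing\<close>

definition supp :: "nat set \<Rightarrow> ((nat \<Rightarrow> nat) \<Rightarrow> real) \<Rightarrow> nat" where
  "supp I f = card {x \<in> Om I. f x \<noteq> 0}"

lemma supp_cong: "(\<And>x. x \<in> Om I \<Longrightarrow> f x = 0 \<longleftrightarrow> g x = 0) \<Longrightarrow> supp I f = supp I g"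
  unfolding supp_def by (intro arg_cong[where f = card]) auto

lemma supp_eq_0_iff: "finite I \<Longrightarrow> supp I f = 0 \<longleftrightarrow> (\<forall>x\<in>Om I. f x = 0)"
  unfolding supp_def using finite_Om by (auto simp: card_eq_0_iff)

lemma supp_as_sum: "finite I \<Longrightarrow> supp I f = (\<Sum>x\<in>Om I. if f x \<noteq> 0 then 1 else 0)"
  unfolding supp_def using finite_Om by (simp add: sum.If_cases Int_def)

lemma supp_split:
  assumes "finite I" "r \<in> I"
  shows "supp I f = (\<Sum>k<q. supp (I - {r}) (slice r k f))"
  using assms(1) by (simp only: supp_as_sum finite_Diff sum_Om_split[OF assms(2)] slice_apply)

lemma supp_diff_le:
  assumes "finite I"
  shows "supp I (\<lambda>x. f x - g x) \<le> supp I f + supp I g"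
proof -
  have "supp I (\<lambda>x. f x - g x) \<le> card ({x \<in> Om I. f x \<noteq> 0} \<union> {x \<in> Om I. g x \<noteq> 0})"
    unfolding supp_def by (rule card_mono) (use finite_Om[OF assms] in auto)
  also have "\<dots> \<le> supp I f + supp I g" unfolding supp_def by (rule card_Un_le)
  finally show ?thesis .
qed

text \<open>\<open>deg d I\<close> is the space \<open>U\<^bsub>[0,d-1]\<^esub>\<close>, described by vanishing mixed differences of order \<open>d\<close>;
  \<open>orth i I\<close> is \<open>U\<^bsub>[i,n]\<^esub>\<close> with \<open>n = card I\<close>: the sum over every subcube that fixes fewer than \<open>i\<close> coordinates
  vanishes.\<close>

primrec deg :: "nat \<Rightarrow> nat set \<Rightarrow> ((nat \<Rightarrow> nat) \<Rightarrow> real) \<Rightarrow> bool" where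
  "deg 0 I f \<longleftrightarrow> (\<forall>x\<in>Om I. f x = 0)"
| "deg (Suc d) I f \<longleftrightarrow>
     (\<forall>r\<in>I. \<forall>k<q. \<forall>m<q. deg d (I - {r}) (\<lambda>x. slice r k f x - slice r m f x))"

primrec orth :: "nat \<Rightarrow> nat set \<Rightarrow> ((nat \<Rightarrow> nat) \<Rightarrow> real) \<Rightarrow> bool" where
  "orth 0 I f \<longleftrightarrow> True"
| "orth (Suc i) I f \<longleftrightarrow>
     (\<Sum>x\<in>Om I. f x) = 0 \<and> (\<forall>r\<in>I. \<forall>k<q. orth i (I - {r}) (slice r k f))"

lemma deg_cong: "(\<And>x. x \<in> Om I \<Longrightarrow> f x = g x) \<Longrightarrow> deg d I f = deg d I g"
proof (induction d arbitrary: I f g)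
  case 0
  then show ?case by simp
next
  case (Suc d)
  have "deg d (I - {r}) (\<lambda>x. slice r k f x - slice r m f x) =
        deg d (I - {r}) (\<lambda>x. slice r k g x - slice r m g x)" if "r \<in> I" "k < q" "m < q" for r k m
    by (rule Suc.IH) (use that Suc.prems Om_upd in \<open>simp del: fun_upd_apply\<close>)
  then show ?case by (simp del: slice_apply)
qed

lemma deg_lin:
  "deg d I f \<Longrightarrow> deg d I g \<Longrightarrow> deg d I (\<lambda>x. a * f x + b * g x)"
proof (induction d arbitrary: I f g)
  case 0
  then show ?case by simp
next
  case (Suc d)
  have "deg d (I - {r}) (\<lambda>x. (a * f (x(r := k)) + b * g (x(r := k)))
          - (a * f (x(r := m)) + b * g (x(r := m))))" if "r \<in> I" "k < q" "m < q" for r k m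
  proof -
    have "deg d (I - {r}) (\<lambda>x. a * (f (x(r := k)) - f (x(r := m))) + b * (g (x(r := k)) - g (x(r := m))))"
      by (rule Suc.IH) (use Suc.prems that in \<open>simp_all del: fun_upd_apply\<close>)
    then show ?thesis by (simp add: algebra_simps)
  qed
  then show ?case by simp
qed

lemma deg_zero: "deg d I (\<lambda>x. 0)"
  by (induction d arbitrary: I) simp_all

lemma deg_sum: "(\<And>t. t \<in> A \<Longrightarrow> deg d I (f t)) \<Longrightarrow> deg d I (\<lambda>x. \<Sum>t\<in>A. f t x)"
proof (induction A rule: infinite_finite_induct)
  case (insert t A)
  then show ?case using deg_lin[of d I "f t" "\<lambda>x. \<Sum>t\<in>A. f t x" 1 1] by simp
qed (simp_all add: deg_zero)

text \<open>Fixing coordinate \<open>r\<close> commutes with taking differences in the other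
  coordinates.\<close>

lemma deg_slice: "deg d I f \<Longrightarrow> r \<in> I \<Longrightarrow> k < q \<Longrightarrow> deg d (I - {r}) (slice r k f)"
proof (induction d arbitrary: I f)
  case 0
  then show ?case by (simp add: Om_upd)
next
  case (Suc d)
  have "deg d (I - {r} - {s}) (\<lambda>x. slice s a (slice r k f) x - slice s b (slice r k f) x)"
    if "s \<in> I - {r}" "a < q" "b < q" for s a b
  proof -
    have "deg d (I - {s} - {r}) (slice r k (\<lambda>x. slice s a f x - slice s b f x))"
      by (rule Suc.IH) (use Suc.prems that in \<open>auto simp del: slice_apply\<close>)
    moreover have "I - {s} - {r} = I - {r} - {s}" by auto
    moreover have "slice r k (\<lambda>x. slice s a f x - slice s b f x)
       = (\<lambda>x. slice s a (slice r k f) x - slice s b (slice r k f) x)"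
      using that by (auto simp: slice_def fun_upd_twist)
    ultimately show ?thesis by simp
  qed
  then show ?case by (simp del: slice_apply)
qed

lemma orth_cong: "(\<And>x. x \<in> Om I \<Longrightarrow> f x = g x) \<Longrightarrow> orth i I f = orth i I g"
proof (induction i arbitrary: I f g)
  case 0
  then show ?case by simp
next
  case (Suc i)
  have "orth i (I - {r}) (slice r k f) = orth i (I - {r}) (slice r k g)" if "r \<in> I" "k < q" for r k
    by (rule Suc.IH) (use that Suc.prems Om_upd in \<open>simp del: fun_upd_apply\<close>)
  then show ?case using Suc.prems by simp
qed

lemma orth_lin:
  "orth i I f \<Longrightarrow> orth i I g \<Longrightarrow> orth i I (\<lambda>x. a * f x + b * g x)"
proof (induction i arbitrary: I f g)
  case 0
  then show ?case by simp
next
  case (Suc i)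
  have "orth i (I - {r}) (slice r k (\<lambda>x. a * f x + b * g x))" if "r \<in> I" "k < q" for r k
    using Suc.IH[of "I - {r}" "slice r k f" "slice r k g"] Suc.prems that
    by (simp add: slice_def)
  then show ?case using Suc.prems by (simp add: sum.distrib flip: sum_distrib_left)
qed

lemma orth_zero: "orth i I (\<lambda>x. 0)"
  by (induction i arbitrary: I) (simp_all add: slice_def)

lemma orth_sum: "(\<And>t. t \<in> A \<Longrightarrow> orth i I (f t)) \<Longrightarrow> orth i I (\<lambda>x. \<Sum>t\<in>A. f t x)"
proof (induction A rule: infinite_finite_induct)
  case (insert t A)
  then show ?case using orth_lin[of i I "f t" "\<lambda>x. \<Sum>t\<in>A. f t x" 1 1] by simp
qed (simp_all add: orth_zero)

text \<open>Summing out \<open>r\<close> commutes with fixing other coordinates and preserves the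
  total sum. So the order \<open>i\<close> is kept, whereas the definition grants a single slice
  only order one less.\<close>

lemma orth_proj:
  "orth i I f \<Longrightarrow> r \<in> I \<Longrightarrow> orth i (I - {r}) (\<lambda>x. \<Sum>k<q. slice r k f x)"
proof (induction i arbitrary: I f)
  case 0
  then show ?case by simp
next
  case (Suc i)
  have "(\<Sum>x\<in>Om (I - {r}). \<Sum>k<q. slice r k f x) = (\<Sum>x\<in>Om I. f x)"
    using Suc.prems(2) by (subst sum.swap) (simp add: sum_Om_split[of r])
  moreover have "orth i (I - {r} - {s}) (slice s a (\<lambda>x. \<Sum>k<q. slice r k f x))"
    if "s \<in> I - {r}" "a < q" for s a
  proof -
    have "orth i (I - {s} - {r}) (\<lambda>x. \<Sum>k<q. slice r k (slice s a f) x)"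
      using Suc.IH[of "I - {s}" "slice s a f"] Suc.prems that by (simp del: slice_apply)
    moreover have "I - {s} - {r} = I - {r} - {s}" by auto
    moreover have "(\<lambda>x. \<Sum>k<q. slice r k (slice s a f) x) = slice s a (\<lambda>x. \<Sum>k<q. slice r k f x)"
      using that by (auto simp: slice_def fun_upd_twist)
    ultimately show ?thesis by simp
  qed
  ultimately show ?case using Suc.prems by (simp del: slice_apply)
qed

lemma all_const_at_sum_zero:
  assumes "finite I" "\<And>r. r \<in> I \<Longrightarrow> const_at r I f" "(\<Sum>x\<in>Om I. f x) = 0" "x \<in> Om I"
  shows "f x = 0"
proof -
  have "(\<Sum>y\<in>Om I. f y) = (\<Sum>y\<in>Om I. f x)"
    by (rule sum.cong[OF refl], rule all_const_at_imp_const[OF assms(1)])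
      (use assms(2,4) in auto)
  then have "real (card (Om I)) * f x = 0" using assms by simp
  then show ?thesis using assms(1) q3 by (simp add: card_Om)
qed

text \<open>The spaces U_[0,d-1] and U_[i,n] meet only in 0. Differences of slices satisfy both
  conditions with \<open>d\<close> and \<open>i\<close> lowered by one, so they vanish by induction;
  \<open>f\<close> is then constant with total sum 0.\<close>

lemma deg_orth_zero:
  "finite I \<Longrightarrow> deg d I f \<Longrightarrow> orth i I f \<Longrightarrow> d \<le> i \<Longrightarrow> x \<in> Om I \<Longrightarrow> f x = 0"
proof (induction d arbitrary: I f i x)
  case 0
  then show ?case by simp
next
  case (Suc d)
  obtain i' where i: "i = Suc i'" using Suc.prems(4) by (cases i) auto
  have "const_at r I f" if r: "r \<in> I" for r
    unfolding const_at_def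
  proof (intro allI impI ballI)
    fix k m x assume *: "k < q" "m < q" "x \<in> Om (I - {r})"
    have "orth i' (I - {r}) (\<lambda>x. slice r k f x - slice r m f x)"
      using orth_lin[of i' "I - {r}" "slice r k f" "slice r m f" 1 "-1"] Suc.prems(3) r * i
      by simp
    moreover have "deg d (I - {r}) (\<lambda>x. slice r k f x - slice r m f x)"
      using Suc.prems r * by (simp del: slice_apply)
    ultimately have "slice r k f x - slice r m f x = 0"
      using Suc.IH[of "I - {r}" "\<lambda>x. slice r k f x - slice r m f x" i' x] Suc.prems i *
      by (simp del: slice_apply)
    then show "f (x(r := k)) = f (x(r := m))" by simp
  qed
  then show ?case using all_const_at_sum_zero[of I f x] Suc.prems i by simp
qed

subsection \<open>Eigenfunctions\<close>

text \<open>The inner sum includes the term \<open>k = x r\<close>, which shifts \<open>\<lambda>\<^sub>t\<close> by \<open>n\<close> to \<open>q (n - t)\<close>.\<close>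

definition eig :: "nat set \<Rightarrow> real \<Rightarrow> ((nat \<Rightarrow> nat) \<Rightarrow> real) \<Rightarrow> bool" where
  "eig I t f \<longleftrightarrow> (\<forall>x\<in>Om I. (\<Sum>r\<in>I. \<Sum>k<q. f (x(r := k))) = real q * (real (card I) - t) * f x)"

text \<open>In the equation at \<open>x(r := a)\<close>, coordinate \<open>r\<close> contributes the
  sum of all slices. This does not depend on \<open>a\<close> and cancels in differences of
  slices.\<close>

lemma eig_slice:
  assumes "finite I" "r \<in> I" "eig I t f" "a < q" "x \<in> Om (I - {r})"
  shows "(\<Sum>s\<in>I - {r}. \<Sum>k<q. slice r a f (x(s := k))) =
         real q * (real (card I) - t) * slice r a f x - (\<Sum>k<q. slice r k f x)"
proof -
  have "(\<Sum>s\<in>I. \<Sum>k<q. f (x(r := a, s := k))) = real q * (real (card I) - t) * f (x(r := a))"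
    using assms Om_upd unfolding eig_def by blast
  moreover have "(\<Sum>s\<in>I. \<Sum>k<q. f (x(r := a, s := k))) =
     (\<Sum>k<q. f (x(r := k))) + (\<Sum>s\<in>I - {r}. \<Sum>k<q. f (x(r := a, s := k)))"
    using assms by (subst sum.remove[of I r]) auto
  moreover have "(\<Sum>s\<in>I - {r}. \<Sum>k<q. f (x(r := a, s := k))) =
     (\<Sum>s\<in>I - {r}. \<Sum>k<q. slice r a f (x(s := k)))"
    by (intro sum.cong) (auto simp: fun_upd_twist)
  ultimately show ?thesis by simp
qed

text \<open>The coefficient \<open>card I - t\<close> is unchanged, so losing a coordinate lowers
  \<open>t\<close> by one.\<close>

lemma eig_diff:
  assumes "finite I" "r \<in> I" "eig I t f" "a < q" "b < q"
  shows "eig (I - {r}) (t - 1) (\<lambda>x. slice r a f x - slice r b f x)"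
  unfolding eig_def sum_subtractf
proof
  fix x assume x: "x \<in> Om (I - {r})"
  have c: "real (card (I - {r})) = real (card I) - 1"
    using assms by (metis card_Suc_Diff1 add_diff_cancel_right' of_nat_Suc add.commute)
  show "(\<Sum>s\<in>I - {r}. \<Sum>k<q. slice r a f (x(s := k))) - (\<Sum>s\<in>I - {r}. \<Sum>k<q. slice r b f (x(s := k)))
      = real q * (real (card (I - {r})) - (t - 1)) * (slice r a f x - slice r b f x)"
    unfolding eig_slice[OF assms(1-4) x] eig_slice[OF assms(1-3,5) x] c
    by (simp add: algebra_simps)
qed

text \<open>Summing \<open>eig_slice\<close> over \<open>a\<close> repeats the correction term
  \<open>q\<close> times. This lowers the coefficient \<open>card I - t\<close> by one, so
  \<open>t\<close> stays.\<close>

lemma eig_proj: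
  assumes "finite I" "r \<in> I" "eig I t f"
  shows "eig (I - {r}) t (\<lambda>x. \<Sum>a<q. slice r a f x)"
  unfolding eig_def
proof
  fix x assume x: "x \<in> Om (I - {r})"
  have c: "real (card (I - {r})) = real (card I) - 1"
    using assms by (metis card_Suc_Diff1 add_diff_cancel_right' of_nat_Suc add.commute)
  have "(\<Sum>s\<in>I - {r}. \<Sum>k<q. \<Sum>a<q. slice r a f (x(s := k)))
     = (\<Sum>s\<in>I - {r}. \<Sum>a<q. \<Sum>k<q. slice r a f (x(s := k)))"
    by (rule sum.cong[OF refl]) (rule sum.swap)
  also have "\<dots> = (\<Sum>a<q. \<Sum>s\<in>I - {r}. \<Sum>k<q. slice r a f (x(s := k)))"
    by (rule sum.swap)
  also have "\<dots> = (\<Sum>a<q. real q * (real (card I) - t) * slice r a f x - (\<Sum>k<q. slice r k f x))"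
    by (intro sum.cong refl eig_slice[OF assms _ x]) simp
  also have "\<dots> = real q * (real (card (I - {r})) - t) * (\<Sum>a<q. slice r a f x)"
    by (simp add: sum_subtractf c left_diff_distrib right_diff_distrib flip: sum_distrib_left)
  finally show "(\<Sum>s\<in>I - {r}. \<Sum>k<q. \<Sum>a<q. slice r a f (x(s := k))) = \<dots>" .
qed

text \<open>Basis for the degree bound. Differences of slices have parameter
  \<open>t - 1 < 0\<close> and vanish by induction on the dimension, so \<open>f\<close> is constant
  in each coordinate and the equation becomes \<open>q * t * f x = 0\<close>.\<close>

lemma eig_negative_zero:
  "finite I \<Longrightarrow> eig I t f \<Longrightarrow> t < 0 \<Longrightarrow> x \<in> Om I \<Longrightarrow> f x = 0"
proof (induction "card I" arbitrary: I t f x rule: less_induct)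
  case less
  have "const_at r I f" if r: "r \<in> I" for r
    unfolding const_at_def
  proof (intro allI impI ballI)
    fix k m x assume *: "k < q" "m < q" "x \<in> Om (I - {r})"
    have "slice r k f x - slice r m f x = 0"
      by (rule less.hyps[OF _ _ eig_diff[OF less.prems(1) r less.prems(2)]])
         (use less.prems r * in \<open>auto intro: card_Diff1_less simp del: card_Diff_insert card_Diff_singleton\<close>)
    then show "f (x(r := k)) = f (x(r := m))" by simp
  qed
  then have "(\<Sum>r\<in>I. \<Sum>k<q. f (x(r := k))) = (\<Sum>r\<in>I. \<Sum>k<q. f x)"
    by (intro sum.cong refl const_at_upd[of _ I]) (use less.prems in auto)
  moreover have "(\<Sum>r\<in>I. \<Sum>k<q. f (x(r := k))) = real q * (real (card I) - t) * f x"
    using less.prems by (simp add: eig_def)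
  ultimately have "real q * t * f x = 0" by (simp add: algebra_simps)
  then show ?case using less.prems(3) q3 by simp
qed

lemma eig_imp_deg: "finite I \<Longrightarrow> eig I t f \<Longrightarrow> t < real d \<Longrightarrow> deg d I f"
proof (induction d arbitrary: I t f)
  case 0
  then show ?case using eig_negative_zero by simp
next
  case (Suc d)
  show ?case unfolding deg.simps
    by (intro ballI allI impI, rule Suc.IH[of _ "t - 1"], use Suc.prems in simp,
        rule eig_diff) (use Suc.prems in auto)
qed

text \<open>Sum the equation over all words: each coordinate contributes \<open>q\<close> times the
  total, which leaves \<open>q * t\<close> times the total equal to 0.\<close>

lemma eig_sum_zero:
  assumes "finite I" "eig I t f" "t \<noteq> 0"
  shows "(\<Sum>x\<in>Om I. f x) = 0"
proof -
  have *: "(\<Sum>x\<in>Om I. \<Sum>k<q. f (x(r := k))) = real q * (\<Sum>x\<in>Om I. f x)" if "r \<in> I" for r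
    using sum.swap[of "\<lambda>x k. f (x(r := k))" "{..<q}" "Om (I - {r})"]
    by (simp add: sum_Om_split[OF that])
  have "(\<Sum>x\<in>Om I. \<Sum>r\<in>I. \<Sum>k<q. f (x(r := k))) = (\<Sum>r\<in>I. \<Sum>x\<in>Om I. \<Sum>k<q. f (x(r := k)))"
    by (rule sum.swap)
  also have "\<dots> = real (card I) * real q * (\<Sum>x\<in>Om I. f x)" by (simp add: *)
  finally have "(\<Sum>x\<in>Om I. real q * (real (card I) - t) * f x) = real (card I) * real q * (\<Sum>x\<in>Om I. f x)"
    using assms(2) by (simp add: eig_def)
  then have "real q * (real (card I) - t) * (\<Sum>x\<in>Om I. f x) = real (card I) * real q * (\<Sum>x\<in>Om I. f x)"
    by (simp only: sum_distrib_left)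
  then have "real q * t * (\<Sum>x\<in>Om I. f x) = 0" by (simp add: algebra_simps)
  then show ?thesis using assms(3) q3 by simp
qed

text \<open>A slice is the average of all slices, with parameter \<open>t\<close>, plus its average
  difference from them, with parameter \<open>t - 1\<close>; the induction hypothesis covers
  both.\<close>

lemma eig_imp_orth: "finite I \<Longrightarrow> eig I t f \<Longrightarrow> real i \<le> t \<Longrightarrow> orth i I f"
proof (induction i arbitrary: I t f)
  case 0
  then show ?case by simp
next
  case (Suc i)
  have "orth i (I - {r}) (slice r k f)" if r: "r \<in> I" and k: "k < q" for r k
  proof -
    have "orth i (I - {r}) (\<lambda>x. \<Sum>a<q. slice r a f x)"
      by (rule Suc.IH[OF _ eig_proj]) (use Suc.prems r in auto)
    moreover have "orth i (I - {r}) (\<lambda>x. \<Sum>m<q. slice r k f x - slice r m f x)"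
      by (rule orth_sum, rule Suc.IH[OF _ eig_diff]) (use Suc.prems r k in auto)
    ultimately have "orth i (I - {r}) (\<lambda>x. (1 / real q) * (\<Sum>a<q. slice r a f x)
        + (1 / real q) * (\<Sum>m<q. slice r k f x - slice r m f x))"
      by (rule orth_lin)
    also have "(\<lambda>x. (1 / real q) * (\<Sum>a<q. slice r a f x)
        + (1 / real q) * (\<Sum>m<q. slice r k f x - slice r m f x)) = slice r k f"
      using q3 by (auto simp: fun_eq_iff sum_subtractf field_simps)
    finally show ?thesis .
  qed
  moreover have "(\<Sum>x\<in>Om I. f x) = 0" using eig_sum_zero Suc.prems by fastforce
  ultimately show ?case by simp
qed

subsection \<open>The lower bound\<close>

lemma two_disjoint_unequal_pairs:
  fixes F :: "nat \<Rightarrow> 'b" and S :: "'b \<Rightarrow> nat"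
  assumes pos: "0 < \<beta>"
    and pair: "\<And>k m. k < q \<Longrightarrow> m < q \<Longrightarrow> F k \<noteq> F m \<Longrightarrow> q * \<beta> \<le> S (F k) + S (F m)"
    and "a < q" "b < q" "c < q" "d < q" "F a \<noteq> F b" "F c \<noteq> F d" "{a, b} \<inter> {c, d} = {}"
  shows "2 * (q - 1) * \<beta> < (\<Sum>k<q. S (F k))"
proof -
  have "a \<noteq> b" "c \<noteq> d" using assms by auto
  then have "S (F a) + S (F b) + (S (F c) + S (F d)) = (\<Sum>k\<in>{a, b, c, d}. S (F k))"
    using assms(9) by (simp add: insert_ident)
  also have "\<dots> \<le> (\<Sum>k<q. S (F k))" by (rule sum_mono2) (use assms in auto)
  finally have "2 * (q * \<beta>) \<le> (\<Sum>k<q. S (F k))"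
    using pair[OF assms(3,4,7)] pair[OF assms(5,6,8)] by linarith
  moreover have "2 * (q - 1) * \<beta> < 2 * (q * \<beta>)"
    using pos q3 by (simp add: diff_mult_distrib)
  ultimately show ?thesis by linarith
qed

text \<open>Join two symbols when \<open>F\<close> differs on them. No symbol meets every edge, so
  there are two disjoint edges or a triangle. A fourth symbol would be joined to a vertex of the
  triangle, and this edge is disjoint from the opposite side.\<close>

lemma unequal_pairs_disjoint_or_triangle:
  fixes F :: "nat \<Rightarrow> 'b"
  assumes "\<not> (\<exists>k<q. \<forall>l<q. \<forall>l'<q. l \<noteq> k \<longrightarrow> l' \<noteq> k \<longrightarrow> F l = F l')"
  obtains (disjoint) a b c d where "a < q" "b < q" "c < q" "d < q" "F a \<noteq> F b" "F c \<noteq> F d"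
      "{a, b} \<inter> {c, d} = {}"
    | (triangle) a b c where "q = 3" "a < q" "b < q" "c < q" "F a \<noteq> F b" "F b \<noteq> F c" "F a \<noteq> F c"
proof -
  have ex: "\<exists>l<q. \<exists>l'<q. l \<noteq> k \<and> l' \<noteq> k \<and> F l \<noteq> F l'" if "k < q" for k
    using assms that by blast
  obtain l m where lm: "l < q" "m < q" "F l \<noteq> F m" using ex[of 0] q3 by auto
  show ?thesis
  proof (cases "\<exists>a<q. \<exists>b<q. F a \<noteq> F b \<and> {l, m} \<inter> {a, b} = {}")
    case True
    then show ?thesis using lm disjoint by blast
  next
    case False
    \<comment> \<open>An edge avoiding \<open>l\<close> must meet \<open>{l, m}\<close>, so it
      contains \<open>m\<close>.\<close>
    obtain b where b: "b < q" "b \<noteq> l" "F m \<noteq> F b" "b \<noteq> m"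
      using ex[OF lm(1)] False lm by (metis disjoint_insert(2) inf_bot_right insertE singletonD)
    \<comment> \<open>An edge avoiding \<open>m\<close> either is disjoint from one of the two edges
      found or closes the triangle.\<close>
    obtain c d where cd: "c < q" "d < q" "c \<noteq> m" "d \<noteq> m" "F c \<noteq> F d" using ex[OF lm(2)] by blast
    show ?thesis
    proof (cases "c \<in> {l, b} \<and> d \<in> {l, b}")
      case False
      then have "{l, m} \<inter> {c, d} = {} \<or> {m, b} \<inter> {c, d} = {}" using cd b(2) by auto
      then show ?thesis
      proof
        assume "{l, m} \<inter> {c, d} = {}"
        then show ?thesis using disjoint[of l m c d] lm cd by blast
      next
        assume "{m, b} \<inter> {c, d} = {}"
        then show ?thesis using disjoint[of m b c d] lm b cd by blast
      qed
    next
      case True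
      then have lb: "F l \<noteq> F b" using cd by auto
      show ?thesis
      proof (cases "q = 3")
        case True
        then show ?thesis using triangle[of l m b] lm b lb by blast
      next
        case False
        then have "\<not> {..<q} \<subseteq> {l, m, b}"
          using q3 card_mono[of "{l, m, b}" "{..<q}"] card_insert_le_m1[of 3 "{m, b}" l]
            card_insert_le_m1[of 2 "{b}" m] by auto
        then obtain e where e: "e < q" "e \<noteq> l" "e \<noteq> m" "e \<noteq> b" by auto
        show ?thesis
        proof (cases "F e = F l")
          case True
          then show ?thesis using disjoint[of e m l b] e lm b lb by auto
        next
          case False
          then show ?thesis using disjoint[of e l m b] e lm b by auto
        qed
      qed
    qed
  qed
qed

text \<open>The values \<open>F k\<close> are the slices of a function along one coordinate, \<open>z\<close> is the zero
  slice, and \<open>S\<close> counts supports.\<close>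

lemma slice_counting:
  fixes F :: "nat \<Rightarrow> 'b" and S :: "'b \<Rightarrow> nat"
  assumes pos: "0 < \<beta>"
    and single: "\<And>k. k < q \<Longrightarrow> F k \<noteq> z \<Longrightarrow> \<beta> \<le> S (F k)"
    and pair: "\<And>k m. k < q \<Longrightarrow> m < q \<Longrightarrow> F k \<noteq> F m \<Longrightarrow> q * \<beta> \<le> S (F k) + S (F m)"
    and ne: "\<exists>k<q. \<exists>m<q. F k \<noteq> F m"
    and isolated: "\<And>k. k < q \<Longrightarrow> (\<forall>l<q. l \<noteq> k \<longrightarrow> F l = z) \<Longrightarrow> 2 * (q - 1) * \<beta> \<le> (\<Sum>k<q. S (F k))"
  shows "2 * (q - 1) * \<beta> \<le> (\<Sum>k<q. S (F k)) \<and>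
    ((\<Sum>k<q. S (F k)) = 2 * (q - 1) * \<beta> \<longrightarrow>
      (\<exists>k<q. (\<forall>l<q. l \<noteq> k \<longrightarrow> F l = z) \<or>
        (S (F k) = (q - 1) * \<beta> \<and>
         (\<forall>l<q. l \<noteq> k \<longrightarrow> S (F l) = \<beta> \<and> (\<forall>l'<q. l' \<noteq> k \<longrightarrow> F l = F l')))))"
proof (cases "\<exists>k<q. \<forall>l<q. \<forall>l'<q. l \<noteq> k \<longrightarrow> l' \<noteq> k \<longrightarrow> F l = F l'")
  case True
  then obtain k where k: "k < q" "\<forall>l<q. \<forall>l'<q. l \<noteq> k \<longrightarrow> l' \<noteq> k \<longrightarrow> F l = F l'" by blast
  obtain m where m: "m < q" "m \<noteq> k" using q3 that[of 0] that[of 1] by (cases "k = 0") auto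
  show ?thesis
  proof (cases "F m = z")
    case True
    then have "\<forall>l<q. l \<noteq> k \<longrightarrow> F l = z" using k m by metis
    then show ?thesis using isolated k(1) by blast
  next
    case False
    let ?s = "S (F m)"
    have "(\<Sum>l<q. S (F l)) = S (F k) + (\<Sum>l\<in>{..<q} - {k}. S (F l))"
      using k(1) by (simp add: sum.remove[of "{..<q}" k])
    also have "(\<Sum>l\<in>{..<q} - {k}. S (F l)) = (\<Sum>l\<in>{..<q} - {k}. ?s)"
      by (rule sum.cong[OF refl], rule arg_cong[where f = S]) (use k m in blast)
    finally have sum: "(\<Sum>l<q. S (F l)) = S (F k) + (q - 1) * ?s" using k(1) by simp
    have km: "F k \<noteq> F m" using ne k m by metis
    have s: "\<beta> \<le> ?s" using single m False by blast
    have p: "q * \<beta> \<le> S (F k) + ?s" using pair k m km by blast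
    have p': "q = Suc (Suc (q - 2))" "q - 2 > 0" using q3 by auto
    then obtain p' where p': "q = Suc (Suc p')" "p' > 0" by blast
    \<comment> \<open>One slice equal to \<open>F m\<close> is paired with \<open>F k\<close>, and
      \<open>p' = q - 2\<close> copies remain. The target splits in the same way as
      \<open>q * \<beta> + p' * \<beta>\<close>, so equality makes both estimates tight;
      \<open>p' > 0\<close> then gives \<open>?s = \<beta>\<close>.\<close>
    have sum': "(\<Sum>l<q. S (F l)) = (S (F k) + ?s) + p' * ?s"
      using sum p' by (simp add: algebra_simps)
    have t: "2 * (q - 1) * \<beta> = q * \<beta> + p' * \<beta>" using p' by (simp add: algebra_simps)
    have le: "p' * \<beta> \<le> p' * ?s" using s by simp
    have "S (F k) = (q - 1) * \<beta> \<and> ?s = \<beta>" if "(\<Sum>k<q. S (F k)) = 2 * (q - 1) * \<beta>"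
    proof -
      have "p' * \<beta> = p' * ?s" "q * \<beta> = S (F k) + ?s"
        using that sum' t le p by linarith+
      then show ?thesis using p' by (simp add: algebra_simps)
    qed
    moreover have "F l = F m" if "l < q" "l \<noteq> k" for l using k m that by blast
    moreover have "2 * (q - 1) * \<beta> \<le> (\<Sum>k<q. S (F k))" using sum' t le p by linarith
    ultimately show ?thesis using k(1) by metis
  qed
next
  case False
  then have "2 * (q - 1) * \<beta> < (\<Sum>k<q. S (F k))"
  proof (cases rule: unequal_pairs_disjoint_or_triangle)
    case (disjoint a b c d)
    then show ?thesis
      using two_disjoint_unequal_pairs[where F = F and S = S, OF pos pair] by blast
  next
    case (triangle a b c)
    \<comment> \<open>The three pair bounds count each slice twice: twice the sum is at least
      \<open>9 * \<beta>\<close>, twice the target is \<open>8 * \<beta>\<close>.\<close>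
    have "a \<noteq> b" "b \<noteq> c" "a \<noteq> c" using triangle by auto
    then have "S (F a) + S (F b) + S (F c) = (\<Sum>k\<in>{a, b, c}. S (F k))" by simp
    also have "\<dots> \<le> (\<Sum>k<q. S (F k))" by (rule sum_mono2) (use triangle in auto)
    finally show ?thesis
      using pair[OF triangle(2,3,5)] pair[OF triangle(3,4,6)] pair[OF triangle(2,4,7)] pos triangle(1)
      by simp
  qed
  then show ?thesis by simp
qed

section \<open>The claimed minimum and its recursions\<close>

definition N :: "nat \<Rightarrow> nat \<Rightarrow> nat \<Rightarrow> nat" where
  "N n i j = 2 ^ i * (q - 1) ^ i * q ^ (n - i - j)"

lemma N_pos: "0 < N n i j"
  using q3 by (simp add: N_def)

lemma N_0: "N n 0 j = q ^ (n - j)"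
  by (simp add: N_def)

text \<open>A coordinate fixed by a delta factor raises \<open>n\<close> and \<open>j\<close>
  without enlarging the support.\<close>

lemma N_Suc_j: "N (Suc n) i (Suc j) = N n i j"
proof -
  have "Suc n - i - Suc j = n - i - j" by arith
  then show ?thesis by (simp only: N_def)
qed

lemma N_Suc_Suc: "N (Suc n) (Suc i) (Suc j) = 2 * (q - 1) * N n i (Suc j)"
  by (simp add: N_def mult_ac)

text \<open>A free coordinate multiplies the support by \<open>q\<close>; the hypothesis keeps the
  subtraction from truncating.\<close>

lemma N_free: "i + j \<le> n \<Longrightarrow> N (Suc n) i j = q * N n i j"
  by (simp add: N_def Suc_diff_le mult_ac)

lemma slices_diff:
  assumes "deg (Suc d) I f" "orth (Suc i) I f" "r \<in> I" "k < q" "m < q"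
  shows "deg d (I - {r}) (\<lambda>x. slice r k f x - slice r m f x)"
    and "orth i (I - {r}) (\<lambda>x. slice r k f x - slice r m f x)"
proof -
  show "deg d (I - {r}) (\<lambda>x. slice r k f x - slice r m f x)"
    using assms by (simp del: slice_apply)
  show "orth i (I - {r}) (\<lambda>x. slice r k f x - slice r m f x)"
    using orth_lin[of i "I - {r}" "slice r k f" "slice r m f" 1 "-1"] assms by simp
qed

text \<open>The only nonzero slice is its difference from a zero slice, which lowers the degree, and
  also the sum of all slices, which keeps the order of orthogonality.\<close>

lemma isolated_slice:
  assumes "deg (Suc d) I f" "orth i I f" "r \<in> I" "k < q"
    and zero: "\<And>l x. l < q \<Longrightarrow> l \<noteq> k \<Longrightarrow> x \<in> Om (I - {r}) \<Longrightarrow> slice r l f x = 0"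
  shows "deg d (I - {r}) (slice r k f)" and "orth i (I - {r}) (slice r k f)"
proof -
  obtain m where m: "m < q" "m \<noteq> k" using q3 that[of 0] that[of 1] by (cases "k = 0") auto
  have "deg d (I - {r}) (\<lambda>x. slice r k f x - slice r m f x)"
    using assms m by (simp del: slice_apply)
  then show "deg d (I - {r}) (slice r k f)"
    by (rule deg_cong[THEN iffD1, rotated]) (use zero m in \<open>simp del: slice_apply\<close>)
  have "(\<Sum>l<q. slice r l f x) = slice r k f x" if "x \<in> Om (I - {r})" for x
    using assms(4) zero that
    by (subst sum.remove[of _ k]) (auto simp del: slice_apply intro!: sum.neutral)
  then show "orth i (I - {r}) (slice r k f)"
    using orth_proj[OF assms(2,3)] orth_cong[of "I - {r}" "\<lambda>x. \<Sum>l<q. slice r l f x" "slice r k f" i]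
    by (simp del: slice_apply)
qed

lemma supp_isolated:
  assumes "finite I" "r \<in> I" "k < q"
    and zero: "\<And>l x. l < q \<Longrightarrow> l \<noteq> k \<Longrightarrow> x \<in> Om (I - {r}) \<Longrightarrow> slice r l f x = 0"
  shows "supp I f = supp (I - {r}) (slice r k f)"
proof -
  have "supp (I - {r}) (slice r l f) = 0" if "l \<in> {..<q} - {k}" for l
    using that zero assms(1) by (simp add: supp_eq_0_iff)
  then show ?thesis
    using assms(3) by (simp add: supp_split[OF assms(1,2)] sum.remove[of "{..<q}" k])
qed

text \<open>The bound for one coordinate set, named so that the slice steps serve both its induction
  and the case of equality.\<close>

definition bounded_supp :: "nat set \<Rightarrow> bool" where
  "bounded_supp I \<longleftrightarrow> (\<forall>i j f. i \<le> j \<longrightarrow> i + j \<le> card I \<longrightarrow> deg (Suc j) I f \<longrightarrow> orth i I f \<longrightarrow>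
     (\<exists>x\<in>Om I. f x \<noteq> 0) \<longrightarrow> N (card I) i j \<le> supp I f)"

lemma bounded_suppD:
  "bounded_supp I \<Longrightarrow> i \<le> j \<Longrightarrow> i + j \<le> card I \<Longrightarrow> deg (Suc j) I f \<Longrightarrow> orth i I f \<Longrightarrow>
     x \<in> Om I \<Longrightarrow> f x \<noteq> 0 \<Longrightarrow> N (card I) i j \<le> supp I f"
  unfolding bounded_supp_def by blast

text \<open>The difference of the two slices is nonzero and is supported on the union of their
  supports.\<close>

lemma pair_bound:
  assumes "bounded_supp (I - {r})" "finite I" "i \<le> j" "i + j \<le> card (I - {r})"
    "deg (Suc j) (I - {r}) (\<lambda>x. slice r k f x - slice r m f x)"
    "orth i (I - {r}) (\<lambda>x. slice r k f x - slice r m f x)"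
    "x \<in> Om (I - {r})" "slice r k f x \<noteq> slice r m f x"
  shows "N (card (I - {r})) i j \<le> supp (I - {r}) (slice r k f) + supp (I - {r}) (slice r m f)"
proof -
  have "N (card (I - {r})) i j \<le> supp (I - {r}) (\<lambda>x. slice r k f x - slice r m f x)"
    by (rule bounded_suppD[OF assms(1,3-7)]) (use assms(8) in simp)
  also have "\<dots> \<le> supp (I - {r}) (slice r k f) + supp (I - {r}) (slice r m f)"
    by (rule supp_diff_le) (use assms(2) in simp)
  finally show ?thesis .
qed

text \<open>For \<open>i = 0\<close> two unequal slices alone already reach the bound for
  \<open>I\<close>, by \<open>N_Suc_j\<close>.\<close>

lemma slice_step_0:
  assumes bnd: "bounded_supp (I - {r})" and fin: "finite I" and r: "r \<in> I"
    and nc: "\<not> const_at r I f" and j: "j \<le> card I" and d: "deg (Suc j) I f"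
  shows "N (card I) 0 j \<le> supp I f \<and> (supp I f = N (card I) 0 j \<longrightarrow>
    (\<exists>k<q. \<forall>l<q. l \<noteq> k \<longrightarrow> (\<forall>x\<in>Om (I - {r}). slice r l f x = 0)))"
proof -
  let ?J = "I - {r}"
  let ?s = "\<lambda>k. supp ?J (slice r k f)"
  have card: "card I = Suc (card ?J)" using card_Suc_Diff1[OF fin r] by simp
  \<comment> \<open>For \<open>j = 0\<close> all differences of slices vanish, against
    \<open>nc\<close>.\<close>
  obtain j' where j': "j = Suc j'"
    using nc d r by (cases j) (auto simp: const_at_def)
  have pair: "N (card I) 0 j \<le> ?s k + ?s m"
    if "k < q" "m < q" "x \<in> Om ?J" "slice r k f x \<noteq> slice r m f x" for k m x
  proof -
    have "0 + j' \<le> card ?J" using j j' card by linarith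
    moreover have "deg (Suc j') ?J (\<lambda>x. slice r k f x - slice r m f x)"
      using d r that unfolding j' deg.simps(2)[of "Suc j'"] by blast
    ultimately show ?thesis unfolding card j' N_Suc_j
      by (intro pair_bound[OF bnd fin _ _ _ _ that(3,4)]) simp_all
  qed
  have sum: "supp I f = (\<Sum>k<q. ?s k)" by (rule supp_split[OF fin r])
  obtain k m x where kmx: "k < q" "m < q" "x \<in> Om ?J" "slice r k f x \<noteq> slice r m f x"
    using nc by (auto simp: const_at_def)
  have "k \<noteq> m" using kmx by auto
  then have "(\<Sum>k<q. ?s k) = ?s k + (?s m + (\<Sum>l\<in>{..<q} - {k} - {m}. ?s l))"
    using kmx by (simp add: sum.remove[of "{..<q}" k] sum.remove[of "{..<q} - {k}" m])
  then have sum2: "supp I f = (?s k + ?s m) + (\<Sum>l\<in>{..<q} - {k} - {m}. ?s l)" using sum by simp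
  have "\<exists>k<q. \<forall>l<q. l \<noteq> k \<longrightarrow> (\<forall>x\<in>Om ?J. slice r l f x = 0)" if eq: "supp I f = N (card I) 0 j"
  proof -
    have "(\<Sum>l\<in>{..<q} - {k} - {m}. ?s l) = 0" and km: "?s k + ?s m = N (card I) 0 j"
      using eq sum2 pair[OF kmx] by linarith+
    then have z: "slice r l f y = 0" if "l < q" "l \<noteq> k" "l \<noteq> m" "y \<in> Om ?J" for l y
      using that fin by (simp add: supp_eq_0_iff)
    \<comment> \<open>A third slice \<open>l\<close> is zero and so differs from slice
      \<open>a\<close>. This pair reaches the bound, hence slice \<open>a\<close> does so alone and
      nothing is left for slice \<open>b\<close>.\<close>
    have key: "\<forall>l<q. l \<noteq> a \<longrightarrow> (\<forall>x\<in>Om ?J. slice r l f x = 0)"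
      if ab: "{a, b} = {k, m}" "slice r a f x \<noteq> 0" for a b
    proof -
      have "\<not> {..<q} \<subseteq> {k, m}"
        using q3 card_mono[of "{k, m}" "{..<q}"] card_insert_le_m1[of 2 "{m}" k] by auto
      then obtain l where l: "l < q" "l \<noteq> k" "l \<noteq> m" by auto
      have a: "a < q" "b < q" "?s a + ?s b = N (card I) 0 j"
        using ab km kmx \<open>k \<noteq> m\<close> by (auto simp: doubleton_eq_iff add.commute)
      have "N (card I) 0 j \<le> ?s a + ?s l"
        by (rule pair[of _ _ x]) (use a l z kmx ab in \<open>auto simp del: slice_apply\<close>)
      moreover have "?s l = 0" using z l fin by (simp add: supp_eq_0_iff)
      ultimately have "?s b = 0" using a by linarith
      then have "\<forall>x\<in>Om ?J. slice r b f x = 0" using fin by (simp add: supp_eq_0_iff)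
      then show ?thesis using z ab(1) by (metis doubleton_eq_iff)
    qed
    show ?thesis
    proof (cases "slice r k f x = 0")
      case True
      then show ?thesis using key[of m k] kmx by (metis insert_commute)
    next
      case False
      then show ?thesis using key[of k m] kmx by blast
    qed
  qed
  moreover have "N (card I) 0 j \<le> supp I f" using sum2 pair[OF kmx] by linarith
  ultimately show ?thesis by blast
qed

text \<open>An instance of \<open>slice_counting\<close>: \<open>\<beta>\<close> bounds a nonzero
  slice and \<open>q * \<beta>\<close> a nonzero difference of slices.\<close>

lemma slice_step_Suc:
  assumes bnd: "bounded_supp (I - {r})" and fin: "finite I" and r: "r \<in> I"
    and nc: "\<not> const_at r I f" and ij: "i \<le> j" "Suc i + Suc j \<le> card I"
    and d: "deg (Suc (Suc j)) I f" and o: "orth (Suc i) I f"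
    and \<beta>: "\<beta> = N (card I - 1) i (Suc j)"
  shows "N (card I) (Suc i) (Suc j) \<le> supp I f \<and> (supp I f = N (card I) (Suc i) (Suc j) \<longrightarrow>
    (\<exists>k<q. (\<forall>l<q. l \<noteq> k \<longrightarrow> (\<forall>x\<in>Om (I - {r}). slice r l f x = 0)) \<or>
      (supp (I - {r}) (slice r k f) = (q - 1) * \<beta> \<and>
       (\<forall>l<q. l \<noteq> k \<longrightarrow> supp (I - {r}) (slice r l f) = \<beta> \<and>
          (\<forall>l'<q. l' \<noteq> k \<longrightarrow> (\<forall>x\<in>Om (I - {r}). slice r l f x = slice r l' f x))))))"
proof -
  let ?J = "I - {r}"
  \<comment> \<open>Restriction to \<open>Om ?J\<close> turns agreement on words into equality of
    functions, as \<open>slice_counting\<close> requires.\<close>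
  define F where "F k = restrict (slice r k f) (Om ?J)" for k
  define z where "z = restrict (\<lambda>_. 0::real) (Om ?J)"
  have F_eq: "F k = F m \<longleftrightarrow> (\<forall>x\<in>Om ?J. slice r k f x = slice r m f x)" for k m
    by (auto simp: F_def restrict_def fun_eq_iff)
  have F_z: "F k = z \<longleftrightarrow> (\<forall>x\<in>Om ?J. slice r k f x = 0)" for k
    by (auto simp: F_def z_def restrict_def fun_eq_iff)
  have S: "supp ?J (F k) = supp ?J (slice r k f)" for k
    by (rule supp_cong) (simp add: F_def)
  have card: "card I = Suc (card ?J)" using card_Suc_Diff1[OF fin r] by simp
  have ij': "i + Suc j \<le> card ?J" "i + j \<le> card ?J" "Suc i + j \<le> card ?J"
    using ij card by linarith+
  have \<beta>': "\<beta> = N (card ?J) i (Suc j)" unfolding \<beta> card by simp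
  \<comment> \<open>Differences have degree one less, which raises their minimum by a factor
    \<open>q\<close>.\<close>
  have q\<beta>: "N (card ?J) i j = q * \<beta>"
    unfolding \<beta>' using N_free[of i "Suc j" "card ?J"] ij'(1) by (simp only: N_Suc_j)
  have sum: "supp I f = (\<Sum>k<q. supp ?J (F k))" unfolding S by (rule supp_split[OF fin r])
  have "2 * (q - 1) * \<beta> \<le> (\<Sum>k<q. supp ?J (F k)) \<and>
    ((\<Sum>k<q. supp ?J (F k)) = 2 * (q - 1) * \<beta> \<longrightarrow>
      (\<exists>k<q. (\<forall>l<q. l \<noteq> k \<longrightarrow> F l = z) \<or>
        (supp ?J (F k) = (q - 1) * \<beta> \<and>
         (\<forall>l<q. l \<noteq> k \<longrightarrow> supp ?J (F l) = \<beta> \<and> (\<forall>l'<q. l' \<noteq> k \<longrightarrow> F l = F l')))))"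
  proof (rule slice_counting)
    show "0 < \<beta>" by (simp add: \<beta> N_pos)
    show "\<beta> \<le> supp ?J (F k)" if "k < q" "F k \<noteq> z" for k
    proof -
      obtain x where x: "x \<in> Om ?J" "slice r k f x \<noteq> 0"
        using \<open>F k \<noteq> z\<close> F_z by blast
      have "orth i ?J (slice r k f)" using o r \<open>k < q\<close> by simp
      with bounded_suppD[where f = "slice r k f", OF bnd _ ij'(1) deg_slice[OF d r \<open>k < q\<close>] _ x]
      show ?thesis unfolding S \<beta>' using ij(1) by simp
    qed
    show "q * \<beta> \<le> supp ?J (F k) + supp ?J (F m)" if km: "k < q" "m < q" "F k \<noteq> F m" for k m
    proof -
      obtain x where x: "x \<in> Om ?J" "slice r k f x \<noteq> slice r m f x" using km F_eq by blast
      show ?thesis unfolding S q\<beta>[symmetric]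
        by (rule pair_bound[OF bnd fin _ _ slices_diff[OF d o r km(1,2)] x]) (rule ij ij')+
    qed
    show "\<exists>k<q. \<exists>m<q. F k \<noteq> F m" using nc unfolding F_eq const_at_def by auto
    show "2 * (q - 1) * \<beta> \<le> (\<Sum>k<q. supp ?J (F k))" if k: "k < q" "\<forall>l<q. l \<noteq> k \<longrightarrow> F l = z" for k
    proof -
      have zero: "slice r l f x = 0" if "l < q" "l \<noteq> k" "x \<in> Om ?J" for l x
        using k F_z that by blast
      note iso = isolated_slice[OF d o r k(1) zero]
      obtain x where x: "x \<in> Om ?J" "slice r k f x \<noteq> 0"
        using nc zero unfolding const_at_def slice_apply by metis
      \<comment> \<open>Otherwise the isolated slice would lie in U_[i+1,j] with an empty range and
        be zero.\<close>
      have "Suc i \<le> j"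
      proof (rule ccontr)
        assume "\<not> Suc i \<le> j"
        then show False using deg_orth_zero[of ?J "Suc j" "slice r k f" "Suc i" x] iso fin x by (simp del: deg.simps orth.simps)
      qed
      moreover have "2 * (q - 1) * \<beta> = N (card ?J) (Suc i) j"
        using \<beta>' N_Suc_Suc[of "card ?J" i j] N_Suc_j[of "card ?J" "Suc i" j] by simp
      ultimately have "2 * (q - 1) * \<beta> \<le> supp ?J (slice r k f)"
        using bounded_suppD[where f = "slice r k f", OF bnd _ ij'(3) iso x] by simp
      then show ?thesis using sum supp_isolated[OF fin r k(1) zero] by simp
    qed
  qed
  then show ?thesis unfolding sum F_eq F_z S card N_Suc_Suc \<beta>'[symmetric] by simp
qed

lemma all_const_at_orth:
  assumes "finite I" "\<And>r. r \<in> I \<Longrightarrow> const_at r I f" "orth i I f" "x \<in> Om I" "f x \<noteq> 0"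
  shows "i = 0"
  using assms all_const_at_sum_zero[OF assms(1,2), of x] by (cases i) auto

lemma all_const_at_supp:
  assumes "finite I" "\<And>r. r \<in> I \<Longrightarrow> const_at r I f" "x \<in> Om I" "f x \<noteq> 0"
  shows "supp I f = q ^ card I"
proof -
  have "f y \<noteq> 0" if "y \<in> Om I" for y
    using all_const_at_imp_const[OF assms(1,2) that assms(3)] assms(4) by simp
  then have "{x \<in> Om I. f x \<noteq> 0} = Om I" by auto
  then show ?thesis using card_Om[OF assms(1)] by (simp add: supp_def)
qed

text \<open>Slicing along a coordinate in which \<open>f\<close> is constant would leave the range \<open>i + j \<le> n\<close> when
  \<open>i + j = n\<close>; hence a nonconstant coordinate is chosen.\<close>

theorem supp_lower_bound: "finite I \<Longrightarrow> bounded_supp I"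
proof (induction "card I" arbitrary: I)
  case 0
  then show ?case unfolding bounded_supp_def
    by (metis N_0 One_nat_def Suc_leI add_is_0 bot_nat_0.extremum_uniqueI neq0_conv supp_eq_0_iff diff_0_eq_0 power_0)
next
  case (Suc n)
  have IH: "bounded_supp (I - {r})" if "r \<in> I" for r
    using Suc that by simp
  show ?case unfolding bounded_supp_def
  proof (intro allI impI)
    fix i j f
    assume *: "i \<le> j" "i + j \<le> card I" "deg (Suc j) I f" "orth i I f" "\<exists>x\<in>Om I. f x \<noteq> 0"
    show "N (card I) i j \<le> supp I f"
    proof (cases "\<forall>r\<in>I. const_at r I f")
      case True
      then have i: "i = 0" and "supp I f = q ^ card I"
        using all_const_at_orth[of I f i] all_const_at_supp[of I f] Suc.prems * by blast+
      then show ?thesis using q3 by (simp add: N_0 power_increasing)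
    next
      case False
      then obtain r where r: "r \<in> I" "\<not> const_at r I f" by blast
      show ?thesis
      proof (cases i)
        case 0
        then show ?thesis using slice_step_0[OF IH Suc.prems r(1) r(2)] r(1) * by auto
      next
        case (Suc i')
        then obtain j' where "j = Suc j'" using *(1) by (cases j) auto
        then show ?thesis
          using slice_step_Suc[OF IH[OF r(1)] Suc.prems r, of i' j'] * Suc by (simp del: deg.simps orth.simps)
      qed
    qed
  qed
qed

text \<open>Joins the equality parts of both slice steps; for \<open>i = 0\<close> only the isolated
  case occurs.\<close>

lemma extremal_slice_cases:
  assumes fin: "finite I" and r: "r \<in> I" "\<not> const_at r I f" and ij: "i \<le> j" "i + j \<le> card I"
    and d: "deg (Suc j) I f" and o: "orth i I f" and eq: "supp I f = N (card I) i j"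
  obtains (isolated) k where "k < q"
      "\<And>l x. l < q \<Longrightarrow> l \<noteq> k \<Longrightarrow> x \<in> Om (I - {r}) \<Longrightarrow> slice r l f x = 0"
    | (split) k i' j' where "k < q" "i = Suc i'" "j = Suc j'"
      "supp (I - {r}) (slice r k f) = (q - 1) * N (card I - 1) i' j"
      "\<And>l. l < q \<Longrightarrow> l \<noteq> k \<Longrightarrow> supp (I - {r}) (slice r l f) = N (card I - 1) i' j"
      "\<And>l l' x. l < q \<Longrightarrow> l \<noteq> k \<Longrightarrow> l' < q \<Longrightarrow> l' \<noteq> k \<Longrightarrow> x \<in> Om (I - {r}) \<Longrightarrow>
         slice r l f x = slice r l' f x"
proof (cases i)
  case 0
  have "\<exists>k<q. \<forall>l<q. l \<noteq> k \<longrightarrow> (\<forall>x\<in>Om (I - {r}). slice r l f x = 0)"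
    using slice_step_0[OF supp_lower_bound fin r, of j] fin ij d eq 0 by (auto simp del: deg.simps slice_apply)
  then show ?thesis using isolated by blast
next
  case (Suc i')
  then obtain j' where j': "j = Suc j'" using ij(1) by (cases j) auto
  have "\<exists>k<q. (\<forall>l<q. l \<noteq> k \<longrightarrow> (\<forall>x\<in>Om (I - {r}). slice r l f x = 0)) \<or>
      (supp (I - {r}) (slice r k f) = (q - 1) * N (card I - 1) i' j \<and>
       (\<forall>l<q. l \<noteq> k \<longrightarrow> supp (I - {r}) (slice r l f) = N (card I - 1) i' j \<and>
          (\<forall>l'<q. l' \<noteq> k \<longrightarrow> (\<forall>x\<in>Om (I - {r}). slice r l f x = slice r l' f x))))"
    using slice_step_Suc[OF supp_lower_bound fin r, of i' j'] fin ij d o eq Suc j'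
    by (simp del: deg.simps orth.simps slice_apply)
  then show ?thesis using isolated split[OF _ Suc j'] by blast
qed

subsection \<open>The case of equality\<close>

text \<open>The products in \<open>F1\<close> up to a permutation, built factor by factor on
  arbitrary coordinate sets, so that no permutation is tracked during the induction.\<close>

inductive extremal :: "nat set \<Rightarrow> nat \<Rightarrow> nat \<Rightarrow> ((nat \<Rightarrow> nat) \<Rightarrow> real) \<Rightarrow> bool" where
  const: "(\<And>x. x \<in> Om I \<Longrightarrow> f x = c) \<Longrightarrow> extremal I 0 0 f"
| delta: "r \<in> I \<Longrightarrow> v < q \<Longrightarrow> extremal (I - {r}) i j (slice r v f) \<Longrightarrow>
    (\<And>x. x \<in> Om I \<Longrightarrow> x r \<noteq> v \<Longrightarrow> f x = 0) \<Longrightarrow> extremal I i (Suc j) f"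
| pair: "r \<in> I \<Longrightarrow> s \<in> I \<Longrightarrow> r \<noteq> s \<Longrightarrow> k < q \<Longrightarrow> m < q \<Longrightarrow> extremal (I - {r} - {s}) i j u \<Longrightarrow>
    (\<And>x a b. x \<in> Om (I - {r} - {s}) \<Longrightarrow> a < q \<Longrightarrow> b < q \<Longrightarrow>
       f (x(r := a, s := b)) = a1 k m [a, b] * u x) \<Longrightarrow> extremal I (Suc i) (Suc j) f"

lemma pair_eval:
  assumes f: "\<And>x a b. x \<in> Om (I - {r} - {s}) \<Longrightarrow> a < q \<Longrightarrow> b < q \<Longrightarrow>
       f (x(r := a, s := b)) = a1 k m [a, b] * u x"
    and rs: "r \<in> I" "s \<in> I" "r \<noteq> s" and x: "x \<in> Om I"
  shows "f x = a1 k m [x r, x s] * u (x(r := undefined, s := undefined))"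
proof -
  let ?z = "x(r := undefined, s := undefined)"
  have "?z \<in> Om (I - {r} - {s})" using x by (intro Om_remove)
  then have "f (?z(r := x r, s := x s)) = a1 k m [x r, x s] * u ?z"
    using f Om_less[OF x] rs by blast
  moreover have "?z(r := x r, s := x s) = x" by (auto simp: fun_eq_iff)
  ultimately show ?thesis by simp
qed

text \<open>Rule \<open>pair\<close> preserves \<open>j - i\<close> and \<open>const\<close> has
  \<open>i = j\<close>, so \<open>i < j\<close> forces a delta factor.\<close>

lemma extremal_delta_coordinate:
  "extremal I i j h \<Longrightarrow> i < j \<Longrightarrow> \<exists>y\<in>I. \<exists>m<q. \<forall>x\<in>Om I. x y \<noteq> m \<longrightarrow> h x = 0"
proof (induction rule: extremal.induct)
  case (const I f c)
  then show ?case by simp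
next
  case (delta r I v i j f)
  then show ?case by blast
next
  case (pair r I s k m i j u f)
  obtain y m' where y: "y \<in> I - {r} - {s}" "m' < q" "\<And>x. x \<in> Om (I - {r} - {s}) \<Longrightarrow> x y \<noteq> m' \<Longrightarrow> u x = 0"
    using pair.IH pair.prems by blast
  have "f x = 0" if x: "x \<in> Om I" "x y \<noteq> m'" for x
  proof -
    have "u (x(r := undefined, s := undefined)) = 0"
      by (rule y(3)) (use x y(1) in \<open>auto intro!: Om_remove\<close>)
    then show ?thesis using pair_eval[of I r s f k m u x, OF pair.hyps(7,1-3) x(1)] by simp
  qed
  then show ?case using y by blast
qed

lemma other_symbol: obtains l where "l < q" "l \<noteq> k" "l \<noteq> m"
proof -
  have "\<not> {..<q} \<subseteq> {k, m}"
    using q3 card_mono[of "{k, m}" "{..<q}"] card_insert_le_m1[of 2 "{m}" k] by auto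
  then show ?thesis using that by auto
qed

text \<open>The isolated slice attains the minimum for \<open>(i, j - 1)\<close>, so the hypothesis
  on \<open>I - {r}\<close> and rule \<open>delta\<close> apply.\<close>

lemma extremal_isolated:
  assumes IH: "\<And>i j f. i \<le> j \<Longrightarrow> i + j \<le> card (I - {r}) \<Longrightarrow> deg (Suc j) (I - {r}) f \<Longrightarrow>
      orth i (I - {r}) f \<Longrightarrow> supp (I - {r}) f = N (card (I - {r})) i j \<Longrightarrow> extremal (I - {r}) i j f"
    and fin: "finite I" and ij: "i + j \<le> card I"
    and d: "deg (Suc j) I f" and o: "orth i I f" and eq: "supp I f = N (card I) i j"
    and r: "r \<in> I" "\<not> const_at r I f" and k: "k < q"
    and zero: "\<And>l x. l < q \<Longrightarrow> l \<noteq> k \<Longrightarrow> x \<in> Om (I - {r}) \<Longrightarrow> slice r l f x = 0"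
  shows "extremal I i j f"
proof -
  let ?J = "I - {r}"
  have card: "card I = Suc (card ?J)" using card_Suc_Diff1[OF fin r(1)] by simp
  obtain j' where j': "j = Suc j'"
    using r d by (cases j) (auto simp: const_at_def)
  note iso = isolated_slice[OF d o r(1) k zero]
  have iso': "deg (Suc j') ?J (slice r k f)" using iso(1) unfolding j' .
  obtain x where x: "x \<in> Om ?J" "slice r k f x \<noteq> 0"
    using r(2) zero unfolding const_at_def slice_apply by metis
  have "i \<le> j'"
    using deg_orth_zero[of ?J "Suc j'" "slice r k f" i x] iso' iso(2) fin x not_less_eq_eq by blast
  moreover have "i + j' \<le> card ?J" using ij card j' by linarith
  moreover have "supp ?J (slice r k f) = N (card ?J) i j'"
    using supp_isolated[OF fin r(1) k zero] eq unfolding card j' N_Suc_j by simp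
  ultimately have "extremal ?J i j' (slice r k f)" using IH iso' iso(2) by blast
  moreover have "f x = 0" if "x \<in> Om I" "x r \<noteq> k" for x
    using zero[of "x r" "x(r := undefined)"] Om_remove[OF that(1)] Om_less[OF that(1) r(1)] that(2)
    by simp
  ultimately show ?thesis unfolding j' using r(1) k by (intro delta)
qed

theorem extremal_if_supp_minimal:
  "finite I \<Longrightarrow> i \<le> j \<Longrightarrow> i + j \<le> card I \<Longrightarrow> deg (Suc j) I f \<Longrightarrow> orth i I f \<Longrightarrow>
     supp I f = N (card I) i j \<Longrightarrow> extremal I i j f"
proof (induction "card I" arbitrary: I i j f rule: less_induct)
  case less
  note fin = less.prems(1) and ij = less.prems(2,3) and d = less.prems(4) and o = less.prems(5)
    and eq = less.prems(6)
  have IH: "extremal K a b g" if "K \<subset> I" "a \<le> b" "a + b \<le> card K" "deg (Suc b) K g" "orth a K g"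
      "supp K g = N (card K) a b" for K a b g
    by (rule less.hyps) (use that fin psubset_card_mono[of I K] finite_subset[of K I] in blast)+
  have "\<exists>x\<in>Om I. f x \<noteq> 0" using eq N_pos fin supp_eq_0_iff by (metis less_irrefl)
  then obtain x1 where x1: "x1 \<in> Om I" "f x1 \<noteq> 0" by blast
  show ?case
  proof (cases "\<forall>r\<in>I. const_at r I f")
    case True
    then have i: "i = 0" and s: "supp I f = q ^ card I"
      using all_const_at_orth[of I f i x1] all_const_at_supp[of I f x1] fin o x1 by blast+
    \<comment> \<open>A nonzero constant has full support, which is minimal only for
      \<open>j = 0\<close>.\<close>
    have "q ^ card I = q ^ (card I - j)" using s eq by (simp add: i N_0)
    then have "j = 0" using q3 ij i by (simp add: power_inject_exp)
    then show ?thesis using i x1 all_const_at_imp_const[OF fin] True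
      by (auto intro!: const[of _ _ "f x1"])
  next
    case False
    then obtain r where r: "r \<in> I" "\<not> const_at r I f" by blast
    have isolated_case: "extremal I i j f"
      if "r \<in> I" "\<not> const_at r I f" "k < q"
        "\<And>l x. l < q \<Longrightarrow> l \<noteq> k \<Longrightarrow> x \<in> Om (I - {r}) \<Longrightarrow> slice r l f x = 0" for r k
      by (rule extremal_isolated[OF _ fin ij(2) d o eq that(1-4)], rule IH) (use that(1) in auto)
    let ?J = "I - {r}"
    have J: "finite ?J" "card I = Suc (card ?J)" "?J \<subset> I" using card_Suc_Diff1[OF fin r(1)] fin r by auto
    from fin r ij d o eq show ?thesis
    proof (cases rule: extremal_slice_cases)
      case (isolated k)
      then show ?thesis using isolated_case r by blast
    next
      case (split k i' j')
      define \<beta> where "\<beta> = N (card ?J) i' j"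
      have \<beta>: "N (card I - 1) i' j = \<beta>" "\<beta> > 0" unfolding J(2) \<beta>_def by (simp_all add: N_pos)
      note split = split[unfolded \<beta>(1)]
      have ij': "i' \<le> j" "i' + j \<le> card ?J" "i' \<le> j'" "i' + j' \<le> card ?J"
        using ij J(2) split(2,3) by linarith+
      have d': "deg (Suc (Suc j')) I f" and o': "orth (Suc i') I f"
        using d o unfolding split(2,3) .
      \<comment> \<open>All slices other than \<open>k\<close> coincide; \<open>?h\<close>
        represents them.\<close>
      obtain l1 where l1: "l1 < q" "l1 \<noteq> k" using other_symbol by metis
      let ?h = "slice r l1 f"
      have "orth i' ?J ?h" using o' r(1) l1(1) by simp
      then have "extremal ?J i' j ?h"
        using IH[OF J(3) ij'(1,2) deg_slice[OF d r(1) l1(1)]] split(5)[OF l1] by (simp add: \<beta>_def)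
      then obtain y m where y: "y \<in> ?J" "m < q" and hy: "\<And>x. x \<in> Om ?J \<Longrightarrow> x y \<noteq> m \<Longrightarrow> ?h x = 0"
        using extremal_delta_coordinate ij'(3) split(3) by (metis le_imp_less_Suc)
      have yr: "y \<in> I" "y \<noteq> r" using y by auto
      let ?K = "?J - {y}"
      have K: "I - {y} - {r} = ?K" by auto
      have K': "card ?J = Suc (card ?K)" "finite ?K" "?K \<subset> I"
        using card_Suc_Diff1[OF J(1) y(1)] J by auto
      obtain l0 where l0: "l0 < q" "l0 \<noteq> m" using other_symbol by metis
      have zJ: "z(y := b) \<in> Om ?J" if "z \<in> Om ?K" "b < q" for z b using Om_upd[OF that(1) y(1) that(2)] .
      have zY: "z(r := a) \<in> Om (I - {y})" if "z \<in> Om ?K" "a < q" for z a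
        using Om_upd[of z "I - {y}" r a] that r(1) yr unfolding K by simp
      have tw: "z(r := a, y := b) = z(y := b, r := a)" for z :: "nat \<Rightarrow> nat" and a b
        using yr by (simp add: fun_upd_twist)
      have f0: "f (z(r := a, y := b)) = 0" if "z \<in> Om ?K" "a < q" "a \<noteq> k" "b < q" "b \<noteq> m" for z a b
        using split(6)[OF that(2,3) l1 zJ[OF that(1,4)]] hy[OF zJ[OF that(1,4)]] that(5) tw by simp
      obtain x0 where x0: "x0 \<in> Om ?J" "?h x0 \<noteq> 0"
        using split(5)[OF l1] \<beta>(2) J(1) supp_eq_0_iff by (metis less_irrefl)
      have x0y: "x0 y = m" using hy x0 by blast
      have p: "x0(r := l1) \<in> Om I" using Om_upd[OF x0(1) r(1) l1(1)] .
      have x0l: "f (x0(r := l1, y := l)) = 0" if "l < q" "l \<noteq> m" for l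
        using hy[of "x0(y := l)"] Om_upd_same[OF x0(1) y(1) that(1)] that(2) tw by simp
      \<comment> \<open>Changing \<open>y\<close> from \<open>m\<close> to \<open>l0\<close> at
        \<open>x0(r := l1)\<close> turns a nonzero value into 0, so the dichotomy is available along
        \<open>y\<close> too.\<close>
      have ncy: "\<not> const_at y I f"
        using const_at_upd[where f = f, OF _ yr(1) p l0(1)] x0l[OF l0] x0(2) by auto
      from fin yr(1) ncy ij d o eq show ?thesis
      proof (cases rule: extremal_slice_cases)
        case (isolated k)
        then show ?thesis using isolated_case yr(1) ncy by blast
      next
        case split': (split k2 i2 j2)
        have i2: "i2 = i'" using split'(2) split(2) by simp
        note split' = split'[unfolded i2 \<beta>(1)]
        \<comment> \<open>Otherwise slice \<open>m\<close> along \<open>y\<close> would agree with a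
          slice \<open>l \<noteq> m\<close>, which vanishes at a word where slice \<open>m\<close>
          does not.\<close>
        have k2: "k2 = m"
        proof (rule ccontr)
          assume "k2 \<noteq> m"
          obtain l where l: "l < q" "l \<noteq> m" "l \<noteq> k2" using other_symbol by metis
          have "slice y m f (x0(r := l1, y := undefined)) = slice y l f (x0(r := l1, y := undefined))"
            using split'(6)[OF y(2) \<open>k2 \<noteq> m\<close>[symmetric] l(1,3) Om_remove[OF p]] .
          moreover have "x0(r := l1, y := m) = x0(r := l1)" using x0y yr by auto
          ultimately show False using x0l[OF l(1,2)] x0(2) by simp
        qed
        have f1: "f (z(r := a, y := b)) = f (z(r := a, y := l0))"
          if "z \<in> Om ?K" "a < q" "b < q" "b \<noteq> m" for z a b
          using split'(6)[of b l0 "z(r := a)"] that l0 zY k2 by simp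
        have f2: "f (z(r := a, y := b)) = f (z(r := l1, y := b))"
          if "z \<in> Om ?K" "a < q" "a \<noteq> k" "b < q" for z a b
          using split(6)[OF that(2,3) l1 zJ[OF that(1,4)]] tw by simp
        \<comment> \<open>By \<open>f1\<close> any symbol other than \<open>m\<close> could replace
          \<open>l0\<close>: this is \<open>f\<close> on \<open>x = k\<close>,
          \<open>y \<noteq> m\<close>.\<close>
        define u where "u z = f (z(r := k, y := l0))" for z
        have su: "supp ?K u = \<beta>"
        proof -
          have "supp (I - {y}) (slice y l0 f) = supp (I - {y} - {r}) (slice r k (slice y l0 f))"
            by (rule supp_isolated) (use fin r(1) yr split(1) f0 l0 K in auto)
          moreover have "slice r k (slice y l0 f) = u" by (auto simp: u_def)
          ultimately show ?thesis using split'(5)[of l0] l0 k2 K by simp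
        qed
        have sh: "supp ?K (\<lambda>z. f (z(r := l1, y := m))) = \<beta>"
        proof -
          have "supp ?J ?h = supp ?K (slice y m ?h)"
            by (rule supp_isolated[OF J(1) y]) (use hy zJ in \<open>simp add: slice_def\<close>)
          moreover have "slice y m ?h = (\<lambda>z. f (z(r := l1, y := m)))" by (auto simp: tw)
          ultimately show ?thesis using split(5)[OF l1] by simp
        qed
        \<comment> \<open>Slice \<open>k\<close> has support \<open>(q - 1) * \<beta>\<close>, and
          its \<open>q - 1\<close> parts with \<open>y \<noteq> m\<close>, all copies of
          \<open>u\<close>, use it up.\<close>
        have fkm: "f (z(r := k, y := m)) = 0" if z: "z \<in> Om ?K" for z
        proof -
          let ?s = "\<lambda>b. supp ?K (slice y b (slice r k f))"
          have "?s b = \<beta>" if "b \<in> {..<q} - {m}" for b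
            unfolding su[symmetric]
            by (rule supp_cong) (use that f1[of _ k b] split(1) in \<open>auto simp: u_def tw[symmetric]\<close>)
          then have "(\<Sum>b<q. ?s b) = ?s m + (q - 1) * \<beta>"
            using y(2) by (simp add: sum.remove[of "{..<q}" m])
          then have "?s m = 0" using supp_split[OF J(1) y(1), of "slice r k f"] split(4) by simp
          then show ?thesis using K'(2) z by (simp add: supp_eq_0_iff tw)
        qed
        \<comment> \<open>This is \<open>u\<close> on \<open>y \<noteq> m\<close> and minus the
          common slice on \<open>y = m\<close>. All \<open>q\<close> slices along \<open>y\<close>
          have support \<open>\<beta>\<close>, so the minimum for \<open>(i', j')\<close> is
          attained.\<close>
        define g where "g x = slice r k f x - ?h x" for x
        have dg: "deg (Suc j') ?J g" and og: "orth i' ?J g"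
          unfolding g_def using slices_diff[OF d' o' r(1) split(1) l1(1)] .
        have g1: "slice y b g z = u z" if "z \<in> Om ?K" "b < q" "b \<noteq> m" for z b
          using f1[OF that(1) split(1) that(2,3)] f0[OF that(1) l1 that(2,3)]
          by (simp add: g_def u_def tw)
        have gm: "slice y m g z = - f (z(r := l1, y := m))" if "z \<in> Om ?K" for z
          using fkm[OF that] by (simp add: g_def tw)
        have sg: "supp ?K (slice y b g) = \<beta>" if "b < q" for b
        proof (cases "b = m")
          case True
          then show ?thesis unfolding sh[symmetric] by (intro supp_cong) (use gm in simp)
        next
          case False
          then show ?thesis unfolding su[symmetric] by (intro supp_cong) (use g1 that in simp)
        qed
        have \<beta>j: "\<beta> = N (card ?K) i' j'" unfolding \<beta>_def split(3) K'(1) N_Suc_j ..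
        have "i' + j' \<le> card ?K" using ij'(2) K'(1) split(3) by linarith
        then have "supp ?J g = N (card ?J) i' j'"
          unfolding supp_split[OF J(1) y(1)] K'(1) using sg by (simp add: N_free \<beta>j)
        \<comment> \<open>An isolated slice would leave a slice of support 0, and a split would give
          \<open>\<beta> = (q - 1) * \<beta>\<close>; both contradict \<open>sg\<close>.\<close>
        have cg: "const_at y ?J g"
        proof (rule ccontr)
          assume "\<not> const_at y ?J g"
          from J(1) y(1) this ij'(3,4) dg og \<open>supp ?J g = N (card ?J) i' j'\<close> show False
          proof (cases rule: extremal_slice_cases)
            case (isolated k3)
            obtain l where l: "l < q" "l \<noteq> k3" using other_symbol by metis
            then have "supp ?K (slice y l g) = 0" using isolated(2) K'(2) supp_eq_0_iff by blast
            then show False using sg l \<beta>(2) by simp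
          next
            case (split k3 i3 j3)
            obtain l where l: "l < q" "l \<noteq> k3" using other_symbol by metis
            then have "\<beta> = (q - 1) * \<beta>" using split(1,4) split(5)[OF l] sg by metis
            then show False using \<beta>(2) q3 by simp
          qed
        qed
        have hu: "f (z(r := l1, y := m)) = - u z" if "z \<in> Om ?K" for z
        proof -
          have "g (z(y := l0)) = g (z(y := m))" using cg l0(1) y(2) that unfolding const_at_def by blast
          then show ?thesis using g1[OF that l0] gm[OF that] by simp
        qed
        have gu: "slice y b g z = u z" if "z \<in> Om ?K" "b < q" for z b
          using g1[OF that] gm[OF that(1)] hu[OF that(1)] by (cases "b = m") auto
        have "deg (Suc j') ?K (slice y m g)" by (rule deg_slice[OF dg y])
        then have du: "deg (Suc j') ?K u"
          using deg_cong[of ?K "slice y m g" u] gu y(2) by blast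
        \<comment> \<open>The average of the slices of \<open>g\<close>, here equal to
          \<open>u\<close>, retains order \<open>i'\<close>; the term \<open>0 * 0\<close> only fits
          the shape of \<open>orth_lin\<close>.\<close>
        have "orth i' ?K (\<lambda>z. (1 / real q) * (\<Sum>b<q. slice y b g z) + 0 * 0)"
          by (rule orth_lin[OF orth_proj[OF og y(1)] orth_zero])
        moreover have "(1 / real q) * (\<Sum>b<q. slice y b g z) + 0 * 0 = u z" if "z \<in> Om ?K" for z
          using gu[OF that] q3 by simp
        ultimately have ou: "orth i' ?K u" using orth_cong by (metis (no_types, lifting))
        have "extremal ?K i' j' u"
          by (rule IH[OF K'(3) ij'(3) \<open>i' + j' \<le> card ?K\<close> du ou]) (simp only: su \<beta>j)
        moreover have "f (z(r := a, y := b)) = a1 k m [a, b] * u z"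
          if z: "z \<in> Om ?K" and "a < q" "b < q" for z a b
          using f0[OF z, of a b] f1[OF z, of a b] f2[OF z, of a b] fkm[OF z] hu[OF z] that
          by (cases "a = k"; cases "b = m") (auto simp: a1_def u_def)
        ultimately show ?thesis unfolding split(2,3)
          using r(1) yr split(1) y(2) by (intro pair[of r I y k m]) auto
      qed
    qed
  qed
qed

end

subsection \<open>Words as lists\<close>

lemma words_nth: "x \<in> words n q \<Longrightarrow> k < n \<Longrightarrow> x ! k < q"
  by (auto simp: words_def subset_iff)

lemma words_Suc: "words (Suc n) q = (\<lambda>(a, x). a # x) ` ({..<q} \<times> words n q)"
  by (auto simp: words_def length_Suc_conv image_iff)

lemma words_0: "words 0 q = {[]}"
  by (auto simp: words_def)

lemma finite_words: "finite (words n q)"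
  unfolding words_def by (rule finite_lists_length_eq) simp

text \<open>A neighbour is determined by the changed position and its new symbol.\<close>

lemma sum_neighbours:
  assumes w: "w \<in> words n q"
  shows "(\<Sum>y | y \<in> words n q \<and> hamming_adj n w y. f y)
       = (\<Sum>r<n. \<Sum>k\<in>{..<q} - {w ! r}. f (w[r := k]))"
proof -
  let ?S = "Sigma {..<n} (\<lambda>r. {..<q} - {w ! r})"
  let ?u = "\<lambda>(r, k). w[r := k]"
  have len: "length w = n" using w by (simp add: words_def)
  have inj: "inj_on ?u ?S"
  proof (rule inj_onI)
    fix p p' assume "p \<in> ?S" "p' \<in> ?S" and eq: "?u p = ?u p'"
    then obtain r k r' k' where p: "p = (r, k)" "p' = (r', k')"
      and *: "r < n" "k \<noteq> w ! r" "r' < n" "k' \<noteq> w ! r'" by auto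
    have u: "w[r := k] = w[r' := k']" using eq p by simp
    then have "r = r'" using * len by (metis nth_list_update_eq nth_list_update_neq)
    then show "p = p'" using u * p len by (metis nth_list_update_eq)
  qed
  have "{y. y \<in> words n q \<and> hamming_adj n w y} = ?u ` ?S"
  proof (intro set_eqI iffI)
    fix y assume "y \<in> {y. y \<in> words n q \<and> hamming_adj n w y}"
    then have y: "y \<in> words n q" "card {k. k < n \<and> w ! k \<noteq> y ! k} = 1" by (auto simp: hamming_adj_def)
    then obtain r where r: "{k. k < n \<and> w ! k \<noteq> y ! k} = {r}" by (auto simp: card_1_singleton_iff)
    then have r': "r < n" "w ! r \<noteq> y ! r" by auto
    have agree: "w ! l = y ! l" if "l < n" "l \<noteq> r" for l using r that by blast
    have "length y = n" using y(1) by (simp add: words_def)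
    then have "y = w[r := y ! r]"
      using len r'(1) by (intro nth_equalityI) (simp_all add: nth_list_update agree)
    moreover have "(r, y ! r) \<in> ?S" using r' words_nth[OF y(1)] by auto
    ultimately show "y \<in> ?u ` ?S" by (intro image_eqI[of _ _ "(r, y ! r)"]) simp_all
  next
    fix y assume "y \<in> ?u ` ?S"
    then obtain r k where y: "r < n" "k < q" "k \<noteq> w ! r" "y = w[r := k]" by auto
    have "set y \<subseteq> {..<q}" using set_update_subset_insert[of w r k] w y by (auto simp: words_def)
    moreover have "{l. l < n \<and> w ! l \<noteq> y ! l} = {r}" using y len by (auto simp: nth_list_update)
    ultimately show "y \<in> {y. y \<in> words n q \<and> hamming_adj n w y}"
      using len y by (simp add: words_def hamming_adj_def)
  qed
  then have "(\<Sum>y | y \<in> words n q \<and> hamming_adj n w y. f y) = (\<Sum>p\<in>?S. f (?u p))"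
    by (simp add: sum.reindex[OF inj])
  also have "\<dots> = (\<Sum>r<n. \<Sum>k\<in>{..<q} - {w ! r}. f (w[r := k]))"
    by (simp add: sum.Sigma split_def)
  finally show ?thesis .
qed

lemma map_upd_upt: "r < n \<Longrightarrow> map (x(r := k)) [0..<n] = (map x [0..<n])[r := k]"
  by (rule nth_equalityI) (auto simp: nth_list_update)

lemma supp_size_permute_fun:
  assumes "\<sigma> permutes {..<n}"
  shows "supp_size n q (permute_fun \<sigma> f) = supp_size n q f"
proof -
  have inv: "inv \<sigma> permutes {..<n}" using assms by (rule permutes_inv)
  have w: "permute_list \<tau> x \<in> words n q" if "\<tau> permutes {..<n}" "x \<in> words n q" for \<tau> x
    using that by (auto simp: words_def set_permute_list)
  have 1: "permute_list (inv \<sigma>) (permute_list \<sigma> x) = x" if "x \<in> words n q" for x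
    using permute_list_compose[of "inv \<sigma>" x \<sigma>] inv that permutes_inv_o[OF assms]
    by (auto simp: words_def)
  have 2: "permute_list \<sigma> (permute_list (inv \<sigma>) x) = x" if "x \<in> words n q" for x
    using permute_list_compose[of \<sigma> x "inv \<sigma>"] assms that permutes_inv_o[OF assms]
    by (auto simp: words_def)
  have "bij_betw (permute_list \<sigma>) {x \<in> words n q. f (permute_list \<sigma> x) \<noteq> 0} {x \<in> words n q. f x \<noteq> 0}"
    by (rule bij_betw_byWitness[where f' = "permute_list (inv \<sigma>)"])
       (use 1 2 w assms inv in auto)
  then show ?thesis by (simp add: supp_size_def permute_fun_def bij_betw_same_card)
qed

section \<open>Supports of block products\<close>

lemma block_prod_append:
  "length x = sum_list (map fst bs) \<Longrightarrow>
     block_prod (bs @ cs) (x @ y) = block_prod bs x * block_prod cs y"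
proof (induction bs arbitrary: x)
  case (Cons b bs)
  obtain m g where b: "b = (m, g)" by fastforce
  have "length (drop m x) = sum_list (map fst bs)" "m \<le> length x" using Cons.prems b by auto
  then show ?case using Cons.IH[of "drop m x"] b by simp
qed simp

text \<open>Cutting words after the first block is a bijection onto pairs, so support sizes
  multiply.\<close>

lemma supp_block_prod:
  "card {x \<in> words (sum_list (map fst bs)) q. block_prod bs x \<noteq> 0}
     = prod_list (map (\<lambda>(m, g). supp_size m q g) bs)"
proof (induction bs)
  case Nil
  then show ?case by (simp add: words_0)
next
  case (Cons b bs)
  obtain m g where b: "b = (m, g)" by fastforce
  let ?n = "sum_list (map fst bs)"
  let ?A = "{x \<in> words m q. g x \<noteq> 0}" and ?B = "{x \<in> words ?n q. block_prod bs x \<noteq> 0}"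
  have inj: "inj_on (\<lambda>(x, y). x @ y) (?A \<times> ?B)"
    by (auto simp: inj_on_def words_def)
  have "{x \<in> words (m + ?n) q. g (take m x) * block_prod bs (drop m x) \<noteq> 0} = (\<lambda>(x, y). x @ y) ` (?A \<times> ?B)"
  proof (intro set_eqI iffI)
    fix x assume x: "x \<in> {x \<in> words (m + ?n) q. g (take m x) * block_prod bs (drop m x) \<noteq> 0}"
    then have "(take m x, drop m x) \<in> ?A \<times> ?B"
      using set_take_subset[of m x] set_drop_subset[of m x] by (auto simp: words_def)
    then show "x \<in> (\<lambda>(x, y). x @ y) ` (?A \<times> ?B)"
      by (metis (no_types, lifting) append_take_drop_id case_prod_conv image_eqI)
  next
    fix x assume "x \<in> (\<lambda>(x, y). x @ y) ` (?A \<times> ?B)"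
    then show "x \<in> {x \<in> words (m + ?n) q. g (take m x) * block_prod bs (drop m x) \<noteq> 0}"
      by (auto simp: words_def)
  qed
  then show ?case using Cons.IH b by (simp add: card_image[OF inj] card_cartesian_product supp_size_def)
qed

lemma supp_size_a1:
  assumes "k < q" "m < q"
  shows "supp_size 2 q (a1 k m) = 2 * (q - 1)"
proof -
  let ?A = "(\<lambda>y. [k, y]) ` ({..<q} - {m})" and ?B = "(\<lambda>x. [x, m]) ` ({..<q} - {k})"
  have "{x \<in> words 2 q. a1 k m x \<noteq> 0} = ?A \<union> ?B"
    using assms by (auto simp: numeral_2_eq_2 words_Suc words_0 a1_def)
  moreover have "card (?A \<union> ?B) = card ?A + card ?B"
    by (rule card_Un_disjoint) auto
  moreover have "card ?A = q - 1" "card ?B = q - 1"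
    using assms by (simp_all add: card_image inj_on_def)
  ultimately show ?thesis by (simp add: supp_size_def)
qed

lemma supp_size_one: "supp_size 1 q (\<lambda>z. 1) = q"
  by (simp add: supp_size_def words_def card_lists_length_eq)

lemma supp_size_a4: "m < q \<Longrightarrow> supp_size 1 q (a4 m) = 1"
proof -
  assume "m < q"
  then have "{x \<in> words 1 q. a4 m x \<noteq> 0} = {[m]}"
    by (auto simp: words_Suc words_0 a4_def)
  then show ?thesis by (simp add: supp_size_def)
qed

lemma prod_list_map_const: "(\<And>x. x \<in> set xs \<Longrightarrow> f x = c) \<Longrightarrow> prod_list (map f xs) = c ^ length xs"
  for c :: "'a :: monoid_mult"
  by (induction xs) auto

lemma supp_size_F1:
  assumes "f \<in> F1 n q i j" "i \<le> j" "i + j \<le> n" "\<exists>x\<in>words n q. f x \<noteq> 0"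
  shows "supp_size n q f = 2 ^ i * (q - 1) ^ i * q ^ (n - i - j)"
proof -
  obtain c gs hs vs where gs: "length gs = i" "set gs \<subseteq> A1 q"
    and hs: "length hs = n - i - j" "set hs \<subseteq> A3" and vs: "length vs = j - i" "set vs \<subseteq> A4 q"
    and f: "\<And>x. x \<in> words n q \<Longrightarrow>
      f x = c * block_prod (map (Pair 2) gs @ map (Pair 1) hs @ map (Pair 1) vs) x"
    using assms(1) unfolding F1_def by blast
  let ?bs = "map (Pair 2) gs @ map (Pair 1) hs @ map (Pair 1) vs"
  \<comment> \<open>\<open>F1\<close> admits \<open>c = 0\<close>; the nonzero value of
    \<open>f\<close> excludes it.\<close>
  have "c \<noteq> 0" using assms(4) f by auto
  have n: "sum_list (map fst ?bs) = n"
    using gs hs vs assms by (simp add: comp_def sum_list_triv)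
  have "supp_size n q f = card {x \<in> words (sum_list (map fst ?bs)) q. block_prod ?bs x \<noteq> 0}"
    unfolding supp_size_def n using f \<open>c \<noteq> 0\<close> by (intro arg_cong[where f = card]) auto
  also have "\<dots> = prod_list (map (\<lambda>(m, g). supp_size m q g) ?bs)"
    by (rule supp_block_prod)
  also have "\<dots> = prod_list (map (supp_size 2 q) gs) * (prod_list (map (supp_size 1 q) hs)
     * prod_list (map (supp_size 1 q) vs))"
    by (simp add: comp_def)
  also have "prod_list (map (supp_size 2 q) gs) = (2 * (q - 1)) ^ i"
    using gs prod_list_map_const[of gs "supp_size 2 q" "2 * (q - 1)"] supp_size_a1 by (auto simp: A1_def)
  also have "prod_list (map (supp_size 1 q) hs) = q ^ (n - i - j)"
    using hs prod_list_map_const[of hs "supp_size 1 q" q] supp_size_one by (auto simp: A3_def)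
  also have "prod_list (map (supp_size 1 q) vs) = 1"
    using vs prod_list_map_const[of vs "supp_size 1 q" 1] supp_size_a4 by (auto simp: A4_def)
  finally show ?thesis by (simp add: power_mult_distrib)
qed

section \<open>Transfer between list words and functions on coordinate sets\<close>

context alphabet
begin

lemma map_Om_words: "x \<in> Om {..<n} \<Longrightarrow> map x [0..<n] \<in> words n q"
  by (auto simp: words_def Om_def PiE_iff)

lemma supp_map: "supp {..<n} (\<lambda>x. f (map x [0..<n])) = supp_size n q f"
proof -
  have 1: "restrict ((!) w) {..<n} \<in> Om {..<n}" if "w \<in> words n q" for w
    using that words_nth by (auto simp: Om_def)
  have 2: "map (restrict ((!) w) {..<n}) [0..<n] = w" if "w \<in> words n q" for w
    using that by (intro nth_equalityI) (auto simp: words_def)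
  have 3: "restrict ((!) (map x [0..<n])) {..<n} = x" if "x \<in> Om {..<n}" for x
    using that by (auto simp: Om_def fun_eq_iff restrict_def PiE_iff extensional_def)
  have "bij_betw (\<lambda>x. map x [0..<n]) {x \<in> Om {..<n}. f (map x [0..<n]) \<noteq> 0} {x \<in> words n q. f x \<noteq> 0}"
    by (rule bij_betw_byWitness[where f' = "\<lambda>w. restrict ((!) w) {..<n}"])
       (use 1 2 3 map_Om_words in auto)
  then show ?thesis by (simp add: supp_def supp_size_def bij_betw_same_card)
qed

lemma eig_map:
  assumes "g \<in> U t n q"
  shows "eig {..<n} (real t) (\<lambda>x. g (map x [0..<n]))"
  unfolding eig_def
proof
  fix x assume x: "x \<in> Om {..<n}"
  let ?w = "map x [0..<n]"
  have w: "?w \<in> words n q" using map_Om_words[OF x] .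
  have "(\<Sum>r<n. \<Sum>k<q. g (map (x(r := k)) [0..<n])) = (\<Sum>r<n. g ?w + (\<Sum>k\<in>{..<q} - {?w ! r}. g (?w[r := k])))"
  proof (rule sum.cong[OF refl])
    fix r assume "r \<in> {..<n}"
    then have r: "r < n" by simp
    have "(\<Sum>k<q. g (map (x(r := k)) [0..<n])) = (\<Sum>k<q. g (?w[r := k]))"
      by (simp only: map_upd_upt[OF r])
    also have "\<dots> = g (?w[r := ?w ! r]) + (\<Sum>k\<in>{..<q} - {?w ! r}. g (?w[r := k]))"
      using words_nth[OF w r] by (intro sum.remove) auto
    finally show "(\<Sum>k<q. g (map (x(r := k)) [0..<n])) = g ?w + (\<Sum>k\<in>{..<q} - {?w ! r}. g (?w[r := k]))"
      by simp
  qed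
  also have "\<dots> = real n * g ?w + eigval t n q * g ?w"
    using assms w sum_neighbours[OF w, of g] by (simp add: sum.distrib U_def eigenfunction_def)
  also have "\<dots> = real q * (real (card {..<n}) - real t) * g ?w"
    by (simp add: eigval_def algebra_simps)
  finally show "(\<Sum>r<n. \<Sum>k<q. g (map (x(r := k)) [0..<n])) = real q * (real (card {..<n}) - real t) * g ?w" .
qed

lemma U_range_deg_orth:
  assumes "f \<in> U_range i j n q"
  shows "deg (Suc j) {..<n} (\<lambda>x. f (map x [0..<n]))" and "orth i {..<n} (\<lambda>x. f (map x [0..<n]))"
proof -
  obtain g where g: "\<And>t. t \<in> {i..j} \<Longrightarrow> g t \<in> U t n q"
    and f: "\<And>x. x \<in> words n q \<Longrightarrow> f x = (\<Sum>t=i..j. g t x)"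
    using assms unfolding U_range_def by blast
  have e: "eig {..<n} (real t) (\<lambda>x. g t (map x [0..<n]))" if "t \<in> {i..j}" for t
    using eig_map g that by blast
  have "deg (Suc j) {..<n} (\<lambda>x. \<Sum>t=i..j. g t (map x [0..<n]))"
    by (rule deg_sum, rule eig_imp_deg[OF _ e]) auto
  then show "deg (Suc j) {..<n} (\<lambda>x. f (map x [0..<n]))"
    by (rule deg_cong[THEN iffD1, rotated]) (use f map_Om_words in simp)
  have "orth i {..<n} (\<lambda>x. \<Sum>t=i..j. g t (map x [0..<n]))"
    by (rule orth_sum, rule eig_imp_orth[OF _ e]) auto
  then show "orth i {..<n} (\<lambda>x. f (map x [0..<n]))"
    by (rule orth_cong[THEN iffD1, rotated]) (use f map_Om_words in simp)
qed

text \<open>\<open>rs\<close> lists the coordinates in the order in which the factors read them.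
  Pairs are added in front and deltas at the end, which keeps the block order of
  \<open>F1\<close>.\<close>

lemma extremal_block_prod:
  "extremal I i j f \<Longrightarrow> finite I \<Longrightarrow> \<exists>rs c gs hs vs. distinct rs \<and> set rs = I \<and>
     length gs = i \<and> set gs \<subseteq> A1 q \<and> length hs + i + j = card I \<and> set hs \<subseteq> A3 \<and>
     length vs + i = j \<and> set vs \<subseteq> A4 q \<and>
     (\<forall>x\<in>Om I. f x = c * block_prod (map (Pair 2) gs @ map (Pair 1) hs @ map (Pair 1) vs) (map x rs))"
proof (induction rule: extremal.induct)
  case (const I f c)
  have one: "block_prod (map (Pair 1) (replicate n (\<lambda>z. 1))) x = 1" for n x
    by (induction n arbitrary: x) auto
  show ?case
    by (rule exI[of _ "sorted_list_of_set I"], rule exI[of _ c], rule exI[of _ "[]"],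
        rule exI[of _ "replicate (card I) (\<lambda>z. 1)"], rule exI[of _ "[]"])
       (use const one in \<open>auto simp: A3_def simp del: map_replicate\<close>)
next
  case (delta r I v i j f)
  obtain rs c gs hs vs where *: "distinct rs" "set rs = I - {r}" "length gs = i" "set gs \<subseteq> A1 q"
    "length hs + i + j = card (I - {r})" "set hs \<subseteq> A3" "length vs + i = j" "set vs \<subseteq> A4 q"
    and f: "\<And>x. x \<in> Om (I - {r}) \<Longrightarrow> slice r v f x =
      c * block_prod (map (Pair 2) gs @ map (Pair 1) hs @ map (Pair 1) vs) (map x rs)"
    using delta.IH delta.prems by (meson finite_Diff)
  let ?bs = "map (Pair 2) gs @ map (Pair 1) hs @ map (Pair 1) vs"
  have card: "Suc (card (I - {r})) = card I" using card_Suc_Diff1 delta by metis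
  have len: "length rs = sum_list (map fst ?bs)"
    using * distinct_card[OF *(1)] by (simp add: comp_def sum_list_triv)
  have "f x = c * block_prod (map (Pair 2) gs @ map (Pair 1) hs @ map (Pair 1) (vs @ [a4 v])) (map x (rs @ [r]))"
    if x: "x \<in> Om I" for x
  proof -
    let ?z = "x(r := undefined)"
    have "map ?z rs = map x rs" using *(2) by auto
    then have "f (x(r := v)) = c * block_prod ?bs (map x rs)"
      using f[OF Om_remove[OF x]] unfolding slice_apply fun_upd_upd by (simp only:)
    moreover have "f x = (if x r = v then f (x(r := v)) else 0)"
      using delta.hyps(4)[OF x] by auto
    moreover have "block_prod (?bs @ [(1, a4 v)]) (map x rs @ [x r]) = block_prod ?bs (map x rs) * (if x r = v then 1 else 0)"
      by (subst block_prod_append) (use len in \<open>auto simp: a4_def\<close>)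
    ultimately show ?thesis by simp
  qed
  moreover have "distinct (rs @ [r])" "set (rs @ [r]) = I" using * delta.hyps(1) by auto
  moreover have "set (vs @ [a4 v]) \<subseteq> A4 q" using *(8) delta.hyps(2) by (auto simp: A4_def)
  moreover have "length (vs @ [a4 v]) + i = Suc j" "length hs + i + Suc j = card I"
    using * card by auto
  ultimately show ?case using *(3,4,6) by blast
next
  case (pair r I s k m i j u f)
  obtain rs c gs hs vs where *: "distinct rs" "set rs = I - {r} - {s}" "length gs = i" "set gs \<subseteq> A1 q"
    "length hs + i + j = card (I - {r} - {s})" "set hs \<subseteq> A3" "length vs + i = j" "set vs \<subseteq> A4 q"
    and u: "\<And>x. x \<in> Om (I - {r} - {s}) \<Longrightarrow> u x =
      c * block_prod (map (Pair 2) gs @ map (Pair 1) hs @ map (Pair 1) vs) (map x rs)"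
    using pair.IH pair.prems by (meson finite_Diff)
  let ?bs = "map (Pair 2) gs @ map (Pair 1) hs @ map (Pair 1) vs"
  have card: "Suc (Suc (card (I - {r} - {s}))) = card I"
    using card_Suc_Diff1[of I r] card_Suc_Diff1[of "I - {r}" s] pair by auto
  have "f x = c * block_prod (map (Pair 2) (a1 k m # gs) @ map (Pair 1) hs @ map (Pair 1) vs) (map x (r # s # rs))"
    if x: "x \<in> Om I" for x
  proof -
    let ?z = "x(r := undefined, s := undefined)"
    have "?z \<in> Om (I - {r} - {s})" using x by (intro Om_remove)
    moreover have "map ?z rs = map x rs" using *(2) by auto
    ultimately have "u ?z = c * block_prod ?bs (map x rs)" using u by metis
    then show ?thesis using pair_eval[of I r s f k m u x, OF pair.hyps(7,1-3) x] by (simp add: numeral_2_eq_2)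
  qed
  moreover have "distinct (r # s # rs)" "set (r # s # rs) = I" using * pair.hyps(1-3) by auto
  moreover have "set (a1 k m # gs) \<subseteq> A1 q" using *(4) pair.hyps(4,5) by (auto simp: A1_def)
  moreover have "length (a1 k m # gs) = Suc i" "length hs + Suc i + Suc j = card I" "length vs + Suc i = Suc j"
    using * card by auto
  ultimately show ?case using *(6,8) by blast
qed

lemma extremal_F1:
  assumes "extremal {..<n} i j (\<lambda>x. f (map x [0..<n]))"
  shows "\<exists>\<sigma>. \<sigma> permutes {..<n} \<and> permute_fun \<sigma> f \<in> F1 n q i j"
proof -
  obtain rs c gs hs vs where rs: "distinct rs" "set rs = {..<n}"
    and *: "length gs = i" "set gs \<subseteq> A1 q"
      "length hs + i + j = n" "set hs \<subseteq> A3" "length vs + i = j" "set vs \<subseteq> A4 q"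
    and f: "\<And>x. x \<in> Om {..<n} \<Longrightarrow> f (map x [0..<n]) =
      c * block_prod (map (Pair 2) gs @ map (Pair 1) hs @ map (Pair 1) vs) (map x rs)"
    using extremal_block_prod[OF assms finite_lessThan] unfolding card_lessThan by blast
  have len: "length rs = n" using distinct_card[OF rs(1)] rs(2) by simp
  define \<tau> where "\<tau> k = (if k < n then rs ! k else k)" for k
  have "bij_betw ((!) rs) {..<n} {..<n}"
    using bij_betw_nth[OF rs(1)] len rs(2) by blast
  then have "bij_betw \<tau> {..<n} {..<n}"
    by (rule bij_betw_cong[THEN iffD1, rotated]) (simp add: \<tau>_def)
  then have \<tau>: "\<tau> permutes {..<n}" by (rule bij_imp_permutes) (simp add: \<tau>_def)
  \<comment> \<open>The \<open>k\<close>-th symbol read by the product sits at coordinate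
    \<open>rs ! k\<close>, so the permuted word must carry \<open>x ! k\<close> there; this calls
    for the inverse of \<open>\<tau>\<close>.\<close>
  define \<sigma> where "\<sigma> = inv \<tau>"
  have \<sigma>: "\<sigma> permutes {..<n}" unfolding \<sigma>_def using \<tau> by (rule permutes_inv)
  have \<sigma>_rs: "\<sigma> (rs ! k) = k" if "k < n" for k
    using permutes_inverses(2)[OF \<tau>, of k] that by (simp add: \<sigma>_def \<tau>_def)
  have "permute_fun \<sigma> f x = c * block_prod (map (Pair 2) gs @ map (Pair 1) hs @ map (Pair 1) vs) x"
    if x: "x \<in> words n q" for x
  proof -
    let ?y = "restrict (\<lambda>i. x ! \<sigma> i) {..<n}"
    have lx: "length x = n" using x by (simp add: words_def)
    have "?y \<in> Om {..<n}"
      using words_nth[OF x] permutes_in_image[OF \<sigma>] by (auto simp: Om_def)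
    moreover have "map ?y [0..<n] = permute_list \<sigma> x"
      by (auto simp: permute_list_def lx)
    moreover have "map ?y rs = x"
    proof (rule nth_equalityI)
      fix k assume "k < length (map ?y rs)"
      then have k: "k < n" using len by simp
      then have "rs ! k < n" using rs(2) len nth_mem by blast
      then show "map ?y rs ! k = x ! k" using \<sigma>_rs[OF k] k len by simp
    qed (simp add: len lx)
    ultimately show ?thesis using f unfolding permute_fun_def by metis
  qed
  moreover have "length hs = n - i - j" "length vs = j - i" using * by auto
  ultimately have "permute_fun \<sigma> f \<in> F1 n q i j" unfolding F1_def using * by blast
  then show ?thesis using \<sigma> by blast
qed

end

theorem theorem1:
  fixes q i j n :: nat and f :: "nat list \<Rightarrow> real"
  assumes "q \<ge> 3" and "i \<le> j" and "n \<ge> i + j"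
    and "f \<in> U_range i j n q"
    and "\<exists>x\<in>words n q. f x \<noteq> 0"
  shows "supp_size n q f \<ge> 2 ^ i * (q - 1) ^ i * q ^ (n - i - j) \<and>
         (supp_size n q f = 2 ^ i * (q - 1) ^ i * q ^ (n - i - j) \<longleftrightarrow>
          (\<exists>\<sigma>. \<sigma> permutes {..<n} \<and> permute_fun \<sigma> f \<in> F1 n q i j))"
proof -
  interpret alphabet q by standard (rule assms(1))
  let ?f = "\<lambda>x. f (map x [0..<n])"
  have d: "deg (Suc j) {..<n} ?f" and o: "orth i {..<n} ?f"
    using U_range_deg_orth[OF assms(4)] .
  have s: "supp {..<n} ?f = supp_size n q f" by (rule supp_map)
  have "supp_size n q f \<noteq> 0" using assms(5) finite_words by (auto simp: supp_size_def)
  then obtain x where x: "x \<in> Om {..<n}" "?f x \<noteq> 0"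
    using s supp_eq_0_iff[of "{..<n}" ?f] by auto
  have "N n i j \<le> supp_size n q f"
    using bounded_suppD[where f = ?f, OF supp_lower_bound[of "{..<n}"] assms(2) _ d o x] assms(3) s by simp
  moreover have "\<exists>\<sigma>. \<sigma> permutes {..<n} \<and> permute_fun \<sigma> f \<in> F1 n q i j" if "supp_size n q f = N n i j"
    by (rule extremal_F1, rule extremal_if_supp_minimal) (use assms d o s that in \<open>simp_all del: deg.simps\<close>)
  \<comment> \<open>Permuting coordinates preserves the support size, so it can be computed from the
    product.\<close>
  moreover have "supp_size n q f = N n i j" if "\<sigma> permutes {..<n}" "permute_fun \<sigma> f \<in> F1 n q i j" for \<sigma>
  proof -
    have "supp_size n q (permute_fun \<sigma> f) \<noteq> 0"
      using \<open>supp_size n q f \<noteq> 0\<close> supp_size_permute_fun[OF that(1)] by simp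
    then have "\<exists>x\<in>words n q. permute_fun \<sigma> f x \<noteq> 0"
      by (auto simp: supp_size_def card_eq_0_iff)
    then show ?thesis
      using supp_size_F1[OF that(2) assms(2,3)] supp_size_permute_fun[OF that(1)] by (simp add: N_def)
  qed
  ultimately show ?thesis unfolding N_def by blast
qed

end
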